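(* Let $t\ge 1$ be an integer and let $\mathcal F\subseteq\Sigma_n$ be a $t$-intersecting family. If $n\ge 130(t+1)(8t)^t$, then $$\gamma_t(\mathcal F)\le \sum_{i=0}^{t}(-1)^i\binom{t}{i}(n-2t-i)!.$$
   Context: $[n]=\{1,\dots,n\}$ and $\Sigma_n$ is the set of all permutations of $[n]$. A permutation $\sigma\in\Sigma_n$ is identified with the $n$-element set $\{(i,\sigma(i)):i\in[n]\}\subset[n]\times[n]$. A family $\mathcal F\subseteq\Sigma_n$ is $t$-intersecting if $|F\cap F'|\ge t$ for all $F,F'\in\mathcal F$ (i.e. any two members agree on at least $t$ positions). A set $S\subset[n]\times[n]$ is a partial permutation if it is contained in some permutation $\sigma\in\Sigma_n$. For $\mathcal F\subseteq\Sigma_n$ and a partial permutation $T$, $\mathcal F(\overline T)=\{F\in\mathcal F:F\cap T=\emptyset\}$. The $t$-diversity of $\mathcal F\subseteq\Sigma_n$ is $$\gamma_t(\mathcal F)=\min\{|\mathcal F(\overline T)|: T\text{ is a partial permutation with }|T|=t\}.$$ *)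

theory Defs
  imports Complex_Main "HOL-Combinatorics.Permutations"
begin

definition perm_graph :: "nat \<Rightarrow> (nat \<Rightarrow> nat) \<Rightarrow> (nat \<times> nat) set" where
  "perm_graph n \<sigma> = {(i, \<sigma> i) | i. i \<in> {1..n}}"

(* Permutations of {1..n}, each identified with its n-element graph, so that
   the intersection of two members is their set of common positions. *)
definition Sigma_perms :: "nat \<Rightarrow> (nat \<times> nat) set set" where
  "Sigma_perms n = perm_graph n ` {\<sigma>. \<sigma> permutes {1..n}}"

definition t_intersecting :: "nat \<Rightarrow> (nat \<times> nat) set set \<Rightarrow> bool" where
  "t_intersecting t \<F> \<longleftrightarrow> (\<forall>F\<in>\<F>. \<forall>F'\<in>\<F>. t \<le> card (F \<inter> F'))"

definition partial_perm :: "nat \<Rightarrow> (nat \<times> nat) set \<Rightarrow> bool" where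
  "partial_perm n S \<longleftrightarrow> (\<exists>P\<in>Sigma_perms n. S \<subseteq> P)"

definition avoiding :: "(nat \<times> nat) set set \<Rightarrow> (nat \<times> nat) set \<Rightarrow> (nat \<times> nat) set set" where
  "avoiding \<F> T = {F \<in> \<F>. F \<inter> T = {}}"

(* For t \<le> n the minimum ranges over a finite nonempty set; for t > n there is
   no partial permutation of size t and the value is unspecified. *)
definition t_diversity :: "nat \<Rightarrow> nat \<Rightarrow> (nat \<times> nat) set set \<Rightarrow> nat" where
  "t_diversity n t \<F> = Min {card (avoiding \<F> T) | T. partial_perm n T \<and> card T = t}"

end

theory Submission
  imports Defs "HOL-Probability.Hoeffding"
begin

text \<open>
  A permutation is a perfect matching of rows and columns. If few members of a family of
  matchings contain any given cell, then almost every matching is disjoint from some member: the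
  fraction of members that a random matching avoids has mean at least \<open>1/3\<close> and is Lipschitz, so
  by a martingale bound it vanishes with exponentially small probability. Hence, if a maximal
  density increment \<open>S\<close> is taken inside the part of \<open>\<F>\<close> not yet covered, the sets \<open>S\<close> obtained in
  this way are \<open>t\<close>-intersecting and cover all but a tiny part of \<open>\<F>\<close>. A minimal \<open>t\<close>-intersecting
  refinement has at most \<open>(k choose t) * k ^ (k - t)\<close> members of size \<open>k\<close> when none is larger, so
  all sets of size above \<open>2 * t\<close> can be discarded, which leaves a kernel \<open>\<T>\<close>.

  If for every \<open>t\<close>-set more members of \<open>\<F>\<close> avoid it than the theorem allows,
  then the kernel contains \<open>A \<union> B\<close>, \<open>A \<union> C\<close>, \<open>B \<union> C\<close> for disjoint \<open>t\<close>-sets \<open>A\<close>, \<open>B\<close>, \<open>C\<close>. Either all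
  members avoiding \<open>A\<close> contain \<open>B \<union> C\<close>, and their number is at most the rook number on the
  right-hand side, or a single exceptional member forces a constant fraction of the members
  avoiding \<open>B\<close> or \<open>C\<close> to disappear.
\<close>

section \<open>Perfect matchings\<close>

text \<open>Bijectivity of both projections treats rows and columns alike and allows different index
  sets, so deleting the rows and columns used by a partial matching leaves an instance of the same
  notion.\<close>

definition matchings :: "'a set \<Rightarrow> 'b set \<Rightarrow> ('a \<times> 'b) set set" where
  "matchings R C = {M. bij_betw fst M R \<and> bij_betw snd M C}"

lemma matchings_subset: "M \<in> matchings R C \<Longrightarrow> M \<subseteq> R \<times> C"
  by (force simp: matchings_def bij_betw_def)

lemma matchings_inj:
  assumes "M \<in> matchings R C"
  shows "inj_on fst M" "inj_on snd M"
  using assms by (auto simp: matchings_def bij_betw_def)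

lemma matchings_fst_eq:
  assumes "M \<in> matchings R C" "(i, y) \<in> M" "(i, z) \<in> M"
  shows "y = z"
  using inj_onD[OF matchings_inj(1)[OF assms(1)], of "(i, y)" "(i, z)"] assms by simp

lemma card_matching: "M \<in> matchings R C \<Longrightarrow> card M = card R"
  by (auto simp: matchings_def bij_betw_same_card)

lemma finite_matching: "finite R \<Longrightarrow> M \<in> matchings R C \<Longrightarrow> finite M"
  by (auto simp: matchings_def bij_betw_finite)

lemma finite_matchings: "finite R \<Longrightarrow> finite C \<Longrightarrow> finite (matchings R C)"
  by (rule finite_subset[of _ "Pow (R \<times> C)"]) (auto dest: matchings_subset)

lemma matchings_empty: "matchings {} {} = {{}}"
  by (auto simp: matchings_def bij_betw_def)

lemma bij_betw_matchings_Un: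
  assumes "inj_on fst S" "inj_on snd S" "fst ` S \<subseteq> R" "snd ` S \<subseteq> C"
  shows "bij_betw ((\<union>) S) (matchings (R - fst ` S) (C - snd ` S)) {M \<in> matchings R C. S \<subseteq> M}"
proof (rule bij_betwI[where g = "\<lambda>M. M - S"])
  show "(\<union>) S \<in> matchings (R - fst ` S) (C - snd ` S) \<rightarrow> {M \<in> matchings R C. S \<subseteq> M}"
  proof (safe)
    fix M assume M: "M \<in> matchings (R - fst ` S) (C - snd ` S)"
    have 1: "bij_betw fst (S \<union> M) (fst ` S \<union> (R - fst ` S))"
      by (rule bij_betw_combine) (use M assms in \<open>auto simp: matchings_def intro: inj_on_imp_bij_betw\<close>)
    have 2: "bij_betw snd (S \<union> M) (snd ` S \<union> (C - snd ` S))"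
      by (rule bij_betw_combine) (use M assms in \<open>auto simp: matchings_def intro: inj_on_imp_bij_betw\<close>)
    have "fst ` S \<union> (R - fst ` S) = R" "snd ` S \<union> (C - snd ` S) = C"
      using assms by auto
    with 1 2 show "S \<union> M \<in> matchings R C"
      by (simp add: matchings_def)
  qed
  show "(\<lambda>M. M - S) \<in> {M \<in> matchings R C. S \<subseteq> M} \<rightarrow> matchings (R - fst ` S) (C - snd ` S)"
  proof (safe)
    fix M assume M: "M \<in> matchings R C" "S \<subseteq> M"
    have "bij_betw fst (M - S) (R - fst ` S)" "bij_betw snd (M - S) (C - snd ` S)"
      using M by (auto simp: matchings_def bij_betw_def inj_on_image_set_diff[of _ M] intro: inj_on_subset)
    then show "M - S \<in> matchings (R - fst ` S) (C - snd ` S)"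
      by (simp add: matchings_def)
  qed
  show "S \<union> x - S = x" if "x \<in> matchings (R - fst ` S) (C - snd ` S)" for x
    using matchings_subset[OF that] by force
  show "S \<union> (x - S) = x" if "x \<in> {M \<in> matchings R C. S \<subseteq> M}" for x
    using that by auto
qed

text \<open>Expansion along row \<open>i\<close>. It drives the count by induction and, later, the
  row-by-row exposure in the concentration bound.\<close>

lemma sum_matchings_insert:
  assumes "finite R" "finite C" "i \<notin> R"
  shows "sum f (matchings (insert i R) C) = (\<Sum>y\<in>C. \<Sum>M\<in>matchings R (C - {y}). f (insert (i, y) M))"
proof -
  let ?P = "\<lambda>y. {M \<in> matchings (insert i R) C. {(i, y)} \<subseteq> M}"
  have "matchings (insert i R) C = (\<Union>y\<in>C. ?P y)"
  proof (intro equalityI subsetI)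
    fix M assume M: "M \<in> matchings (insert i R) C"
    then have "i \<in> fst ` M" by (auto simp: matchings_def bij_betw_def)
    then obtain y where "(i, y) \<in> M" by auto
    with M matchings_subset[OF M] show "M \<in> (\<Union>y\<in>C. ?P y)" by auto
  qed auto
  then have "sum f (matchings (insert i R) C) = sum f (\<Union>y\<in>C. ?P y)"
    by (rule arg_cong)
  also have "\<dots> = (\<Sum>y\<in>C. sum f (?P y))"
    by (rule sum.UNION_disjoint)
      (use assms in \<open>auto intro!: finite_matchings dest: matchings_fst_eq\<close>)
  also have "\<dots> = (\<Sum>y\<in>C. \<Sum>M\<in>matchings R (C - {y}). f (insert (i, y) M))"
  proof (rule sum.cong)
    fix y assume "y \<in> C"
    then have "bij_betw ((\<union>) {(i, y)}) (matchings R (C - {y})) (?P y)"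
      using bij_betw_matchings_Un[of "{(i, y)}" "insert i R" C] assms by simp
    then show "sum f (?P y) = (\<Sum>M\<in>matchings R (C - {y}). f (insert (i, y) M))"
      using sum.reindex_bij_betw[of "(\<union>) {(i, y)}" "matchings R (C - {y})" "?P y" f] by simp
  qed simp
  finally show ?thesis .
qed

lemma card_matchings:
  assumes "finite R" "finite C" "card R = card C"
  shows "card (matchings R C) = fact (card R)"
  using assms
proof (induction R arbitrary: C rule: finite_induct)
  case empty
  then show ?case by (simp add: matchings_empty)
next
  case (insert i R)
  have "card (matchings (insert i R) C) = (\<Sum>y\<in>C. card (matchings R (C - {y})))"
    using sum_matchings_insert[of R C i "\<lambda>_. 1::nat"] insert by simp
  also have "\<dots> = (\<Sum>y\<in>C. fact (card R))"
    using insert by (intro sum.cong refl insert.IH) auto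
  finally show ?case using insert.hyps insert.prems(2)[symmetric] by simp
qed

lemma card_matchings_superset:
  assumes "finite R" "finite C" "card R = card C"
    and "inj_on fst S" "inj_on snd S" "S \<subseteq> R \<times> C"
  shows "card {M \<in> matchings R C. S \<subseteq> M} = fact (card R - card S)"
proof -
  have S: "fst ` S \<subseteq> R" "snd ` S \<subseteq> C"
    using assms by auto
  then have fin: "finite (fst ` S)" "finite (snd ` S)"
    using assms(1,2) by (auto intro: finite_subset)
  have "card {M \<in> matchings R C. S \<subseteq> M} = card (matchings (R - fst ` S) (C - snd ` S))"
    using bij_betw_matchings_Un[OF assms(4,5) S] by (simp add: bij_betw_same_card)
  also have "\<dots> = fact (card (R - fst ` S))"
    using assms(1-5) S fin by (intro card_matchings) (auto simp: card_Diff_subset card_image)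
  also have "card (R - fst ` S) = card R - card S"
    using assms(1,4) S fin by (simp add: card_Diff_subset card_image)
  finally show ?thesis .
qed

text \<open>\<open>S\<close> is arbitrary here: either it lies in no matching and the left side is
  zero, or it inherits injectivity of both projections from a matching.\<close>

lemma card_matchings_superset_le:
  assumes "finite R" "finite C" "card R = card C"
  shows "card {M \<in> matchings R C. S \<subseteq> M} \<le> fact (card R - card S)"
proof (cases "{M \<in> matchings R C. S \<subseteq> M} = {}")
  case False
  then obtain M where M: "M \<in> matchings R C" "S \<subseteq> M" by auto
  have "card {M \<in> matchings R C. S \<subseteq> M} = fact (card R - card S)"
    by (rule card_matchings_superset)
      (use assms M matchings_subset[OF M(1)] in
        \<open>auto intro: inj_on_subset[OF matchings_inj(1)] inj_on_subset[OF matchings_inj(2)]\<close>)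
  then show ?thesis by simp
next
  case True
  show ?thesis unfolding True by simp
qed

section \<open>Matchings that avoid a partial matching\<close>

text \<open>By inclusion-exclusion this counts the matchings of an \<open>m\<close> by
  \<open>m\<close> board avoiding \<open>k \<le> m\<close> cells in distinct rows and columns. It is
  integer-valued because the sum alternates; \<open>rook (n - 2 * t) t\<close> is the bound of the
  theorem.\<close>

definition rook :: "nat \<Rightarrow> nat \<Rightarrow> int" where
  "rook m k = (\<Sum>i = 0..k. (-1) ^ i * int (k choose i) * fact (m - i))"

lemma rook_0 [simp]: "rook m 0 = fact m"
  by (simp add: rook_def)

text \<open>Pascal's rule. In terms of counts, forbidding one more cell removes the matchings
  through it, which live on the board without its row and column.\<close>

lemma rook_Suc: "rook m (Suc k) = rook m k - rook (m - 1) k"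
proof -
  have "rook m (Suc k) = fact m + (\<Sum>i = 0..k. (-1) ^ Suc i * int (Suc k choose Suc i) * fact (m - Suc i))"
    unfolding rook_def by (subst sum.atLeast0_atMost_Suc_shift) simp
  also have "\<dots> = (fact m + (\<Sum>i = 0..k. (-1) ^ Suc i * int (k choose Suc i) * fact (m - Suc i)))
     - (\<Sum>i = 0..k. (-1) ^ i * int (k choose i) * fact (m - 1 - i))"
    unfolding add_diff_eq[symmetric] sum_subtractf[symmetric]
    by (intro arg_cong2[where f = "(+)"] sum.cong refl) (simp add: algebra_simps)
  also have "fact m + (\<Sum>i = 0..k. (-1) ^ Suc i * int (k choose Suc i) * fact (m - Suc i))
    = (\<Sum>i = 0..Suc k. (-1) ^ i * int (k choose i) * fact (m - i))"
    by (subst sum.atLeast0_atMost_Suc_shift) simp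
  also have "\<dots> = rook m k"
    by (simp add: rook_def)
  finally show ?thesis by (simp add: rook_def)
qed

text \<open>Induction over the cells mirrors \<open>rook_Suc\<close>: among the matchings avoiding
  \<open>K\<close>, those through \<open>x\<close> are removed. The board without the row and column
  of \<open>x\<close> still contains all of \<open>K\<close>, since no two cells of
  \<open>insert x K\<close> share a row or column.\<close>

lemma card_matchings_avoiding:
  assumes "finite K" "finite R" "finite C" "card R = card C"
    and "inj_on fst K" "inj_on snd K" "K \<subseteq> R \<times> C"
  shows "int (card {M \<in> matchings R C. M \<inter> K = {}}) = rook (card R) (card K)"
  using assms
proof (induction K arbitrary: R C rule: finite_induct)
  case empty
  then show ?case by (simp add: card_matchings)
next
  case (insert x K)
  obtain i y where x: "x = (i, y)" by (cases x)
  let ?R = "R - {i}" and ?C = "C - {y}"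
  let ?A = "{M \<in> matchings R C. M \<inter> K = {}}" and ?B = "{M \<in> matchings R C. {x} \<subseteq> M \<and> M \<inter> K = {}}"
  have iy: "i \<in> R" "y \<in> C" using insert.prems x by auto
  have fin: "finite ?A" using insert.prems by (simp add: finite_matchings)
  have "{M \<in> matchings R C. M \<inter> insert x K = {}} = ?A - ?B" by auto
  moreover have "card (?A - ?B) = card ?A - card ?B"
    by (intro card_Diff_subset finite_subset[OF _ fin]) auto
  moreover have "card ?B \<le> card ?A"
    using fin by (intro card_mono) auto
  ultimately have 1: "int (card {M \<in> matchings R C. M \<inter> insert x K = {}}) = int (card ?A) - int (card ?B)"
    by simp
  have "bij_betw ((\<union>) {x}) (matchings ?R ?C) {M \<in> matchings R C. {x} \<subseteq> M}"
    using bij_betw_matchings_Un[of "{x}" R C] iy x by simp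
  then have "bij_betw ((\<union>) {x}) {M \<in> matchings ?R ?C. M \<inter> K = {}} ?B"
  proof (rule bij_betw_subset)
    have "?B = {M \<in> (\<union>) {x} ` matchings ?R ?C. M \<inter> K = {}}"
      using \<open>bij_betw ((\<union>) {x}) _ _\<close> by (auto simp: bij_betw_def)
    also have "\<dots> = (\<union>) {x} ` {M \<in> matchings ?R ?C. M \<inter> K = {}}"
      using insert.hyps by auto
    finally show "(\<union>) {x} ` {M \<in> matchings ?R ?C. M \<inter> K = {}} = ?B" ..
  qed auto
  then have "card ?B = card {M \<in> matchings ?R ?C. M \<inter> K = {}}"
    by (simp add: bij_betw_same_card)
  moreover have "K \<subseteq> ?R \<times> ?C"
  proof
    fix z assume z: "z \<in> K"
    have "fst z \<noteq> i" "snd z \<noteq> y"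
      using insert.prems(4,5) insert.hyps(2) z inj_onD[of _ "insert x K" z x]
      by (auto simp: x simp del: inj_on_insert)
    moreover have "z \<in> R \<times> C" using z insert.prems(6) by blast
    ultimately show "z \<in> ?R \<times> ?C" by (auto simp: mem_Times_iff)
  qed
  then have "int (card {M \<in> matchings ?R ?C. M \<inter> K = {}}) = rook (card ?R) (card K)"
    using insert.prems(1-5) iy by (intro insert.IH) (auto simp del: inj_on_insert intro: inj_on_subset[OF insert.prems(4)] inj_on_subset[OF insert.prems(5)])
  moreover have "int (card ?A) = rook (card R) (card K)"
    using insert.prems by (intro insert.IH) (auto simp del: inj_on_insert intro: inj_on_subset[OF insert.prems(4)] inj_on_subset[OF insert.prems(5)])
  moreover have "card ?R = card R - 1" "card (insert x K) = Suc (card K)"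
    using insert.hyps iy by simp_all
  ultimately show ?case
    using 1 \<open>card ?B = _\<close> by (simp only: rook_Suc)
qed

text \<open>A concrete board with the forbidden cells on the diagonal makes the sign and the upper
  bound of \<open>rook\<close> immediate.\<close>

lemma rook_eq_card:
  assumes "k \<le> m"
  shows "rook m k = int (card {M \<in> matchings {..<m} {..<m}. M \<inter> Id_on {..<k} = {}})"
proof -
  have "inj_on (\<lambda>i. (i, i)) {..<k}" by (auto simp: inj_on_def)
  moreover have "Id_on {..<k} = (\<lambda>i. (i, i)) ` {..<k}" by auto
  ultimately have "card (Id_on {..<k}) = k" by (simp add: card_image)
  moreover have "inj_on fst (Id_on {..<k})" "inj_on snd (Id_on {..<k})" "Id_on {..<k} \<subseteq> {..<m} \<times> {..<m}"
    "finite (Id_on {..<k})"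
    using assms by (auto simp: inj_on_def Id_on_def)
  ultimately show ?thesis
    using card_matchings_avoiding[of "Id_on {..<k}" "{..<m}" "{..<m}"] by simp
qed

lemma rook_nonneg: "k \<le> m \<Longrightarrow> 0 \<le> rook m k"
  by (simp add: rook_eq_card)

lemma rook_le_fact:
  assumes "k \<le> m"
  shows "rook m k \<le> fact m"
proof -
  have "card {M \<in> matchings {..<m} {..<m}. M \<inter> Id_on {..<k} = {}} \<le> card (matchings {..<m} {..<m})"
    by (intro card_mono finite_matchings) auto
  also have "\<dots> = fact m" by (simp add: card_matchings)
  finally have "int (card {M \<in> matchings {..<m} {..<m}. M \<inter> Id_on {..<k} = {}}) \<le> int (fact m)"
    by (simp only: of_nat_le_iff)
  then show ?thesis by (simp add: rook_eq_card assms)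
qed

lemma rook_antimono:
  assumes "k \<le> l" "l \<le> m"
  shows "rook m l \<le> rook m k"
  using assms
proof (induction l rule: dec_induct)
  case (step l)
  then have "l \<le> m - 1" by simp
  from rook_nonneg[OF this] step show ?case by (simp add: rook_Suc)
qed simp

text \<open>First of three Bonferroni truncations. Since \<open>rook_Suc\<close> subtracts a rook
  number, an upper bound with fewer terms yields a lower bound with one more term, and
  conversely.\<close>

lemma rook_ge_linear:
  assumes "k \<le> m"
  shows "fact m - int k * fact (m - 1) \<le> rook m k"
  using assms
proof (induction k)
  case (Suc k)
  then have "k \<le> m - 1" by simp
  from rook_le_fact[OF this] Suc show ?case by (simp add: rook_Suc algebra_simps)
qed simp

lemma rook_le_quadratic:
  assumes "k \<le> m"
  shows "rook m k \<le> fact m - int k * fact (m - 1) + int (k choose 2) * fact (m - 2)"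
  using assms
proof (induction k)
  case (Suc k)
  then have "k \<le> m - 1" by simp
  from rook_ge_linear[OF this] Suc show ?case
    by (simp add: rook_Suc algebra_simps numeral_2_eq_2)
qed simp

lemma rook_ge_cubic:
  assumes "k \<le> m"
  shows "fact m - int k * fact (m - 1) + int (k choose 2) * fact (m - 2) - int (k choose 3) * fact (m - 3)
    \<le> rook m k"
  using assms
proof (induction k)
  case (Suc k)
  then have "k \<le> m - 1" by simp
  from rook_le_quadratic[OF this] Suc show ?case
    by (simp add: rook_Suc algebra_simps numeral_2_eq_2 numeral_3_eq_3)
qed (simp add: numeral_2_eq_2 numeral_3_eq_3)

text \<open>The worst case is \<open>k = m\<close>, where the cubic truncation equals
  \<open>1 - 1 + 1/2 - 1/6 = 1/3\<close> of \<open>fact m\<close>.\<close>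

lemma rook_ge_third:
  assumes "k \<le> m" "3 \<le> m"
  shows "fact m \<le> 3 * rook m k"
proof -
  have "fact 2 * fact (m - 2) * (m choose 2) = (fact m :: nat)"
    "fact 3 * fact (m - 3) * (m choose 3) = (fact m :: nat)" "m * fact (m - 1) = (fact m :: nat)"
    using assms binomial_fact_lemma[of 2 m] binomial_fact_lemma[of 3 m] fact_reduce[of m, where 'a = nat]
    by simp_all
  from this[THEN arg_cong[of _ _ int]]
  have "2 * (int (m choose 2) * fact (m - 2)) = fact m" "6 * (int (m choose 3) * fact (m - 3)) = fact m"
    "int m * fact (m - 1) = fact m"
    by (simp_all add: fact_numeral algebra_simps)
  then have "fact m \<le> 3 * rook m m"
    using rook_ge_cubic[of m m] by simp
  also have "\<dots> \<le> 3 * rook m k"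
    using rook_antimono[of k m m] assms by simp
  finally show ?thesis .
qed

section \<open>Concentration on matchings\<close>

text \<open>Hoeffding's lemma for the uniform distribution on \<open>C\<close>, multiplied out to a
  finite sum. Since \<open>c\<close> bounds all differences of values, they lie in an interval of
  length \<open>c\<close> that starts at the minimum.\<close>

lemma sum_exp_le_Hoeffding:
  fixes f :: "'a \<Rightarrow> real"
  assumes "finite C" "C \<noteq> {}" "l > 0"
    and osc: "\<And>y z. y \<in> C \<Longrightarrow> z \<in> C \<Longrightarrow> f y - f z \<le> c"
  shows "(\<Sum>y\<in>C. exp (l * f y)) \<le> real (card C) * exp (l * (sum f C / real (card C)) + l\<^sup>2 * c\<^sup>2 / 8)"
proof -
  define p where "p = measure_pmf (pmf_of_set C)"
  define a where "a = Min (f ` C)"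
  define \<mu> where "\<mu> = sum f C / real (card C)"
  have a: "a \<le> f y" "f y \<le> a + c" if "y \<in> C" for y
  proof -
    show "a \<le> f y" using that assms by (simp add: a_def)
    have "a \<in> f ` C" unfolding a_def using assms by (intro Min_in) auto
    then show "f y \<le> a + c" using osc[OF that] by force
  qed
  interpret prob_space p
    unfolding p_def by (rule measure_pmf.prob_space_axioms)
  interpret interval_bounded_random_variable p f a "a + c"
  proof unfold_locales
    show "f \<in> borel_measurable p"
      by (simp add: p_def)
    show "AE x in p. f x \<in> {a..a + c}"
      unfolding p_def using a assms by (intro AE_pmfI) auto
  qed
  have E: "expectation f = \<mu>"
    using assms by (simp add: p_def \<mu>_def integral_pmf_of_set)
  have "ennreal ((\<Sum>y\<in>C. exp (l * (f y - \<mu>))) / real (card C)) = nn_integral p (\<lambda>x. exp (l * (f x - \<mu>)))"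
    using assms by (simp add: p_def nn_integral_pmf_of_set sum_nonneg divide_ennreal ennreal_of_nat_eq_real_of_nat card_gt_0_iff)
  also have "\<dots> \<le> ennreal (exp (l\<^sup>2 * c\<^sup>2 / 8))"
    using Hoeffdings_lemma_nn_integral[OF \<open>l > 0\<close>] by (simp add: E)
  finally have "(\<Sum>y\<in>C. exp (l * (f y - \<mu>))) / real (card C) \<le> exp (l\<^sup>2 * c\<^sup>2 / 8)"
    by simp
  then have "(\<Sum>y\<in>C. exp (l * (f y - \<mu>))) \<le> exp (l\<^sup>2 * c\<^sup>2 / 8) * real (card C)"
    using assms by (simp add: divide_simps card_gt_0_iff)
  have "(\<Sum>y\<in>C. exp (l * f y)) = exp (l * \<mu>) * (\<Sum>y\<in>C. exp (l * (f y - \<mu>)))"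
    by (simp add: sum_distrib_left algebra_simps flip: exp_add)
  also have "\<dots> \<le> exp (l * \<mu>) * (exp (l\<^sup>2 * c\<^sup>2 / 8) * real (card C))"
    by (intro mult_left_mono) (fact, simp)
  also have "\<dots> = real (card C) * exp (l * \<mu> + l\<^sup>2 * c\<^sup>2 / 8)"
    unfolding exp_add by (simp only: mult_ac)
  finally show ?thesis
    by (simp only: \<mu>_def)
qed

text \<open>Exchanging two columns couples the two conditional distributions of the remaining
  matching, given that a further row is matched to \<open>y\<close> or to \<open>z\<close>.\<close>

lemma matchings_swap:
  assumes "y \<in> C" "z \<in> C"
  shows "bij_betw ((`) (map_prod id (Transposition.transpose y z))) (matchings R (C - {y})) (matchings R (C - {z}))"
proof -
  let ?\<tau> = "map_prod id (Transposition.transpose y z)"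
  have inv: "?\<tau> ` ?\<tau> ` M = M" for M :: "('b \<times> 'a) set"
    by (simp add: image_image map_prod_def split_beta)
  have *: "?\<tau> ` M \<in> matchings R (C - {v})"
    if "M \<in> matchings R (C - {u})" "{u, v} = {y, z}" for M :: "('b \<times> 'a) set" and u v
  proof -
    have inj: "inj ?\<tau>" by (intro prod.inj_map) auto
    have "bij_betw (fst \<circ> ?\<tau>) M R"
      using that by (simp add: matchings_def)
    moreover have "bij_betw (snd \<circ> ?\<tau>) M (C - {v})"
    proof -
      have "bij_betw (Transposition.transpose y z) (C - {u}) (Transposition.transpose y z ` (C - {u}))"
        by (simp add: inj_on_imp_bij_betw)
      also have "Transposition.transpose y z ` (C - {u}) = C - {v}"
        using that(2) assms by (auto simp: Transposition.transpose_def image_iff doubleton_eq_iff)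
      finally have "bij_betw (Transposition.transpose y z \<circ> snd) M (C - {v})"
        using that(1) by (auto simp: matchings_def intro: bij_betw_trans)
      then show ?thesis by simp
    qed
    ultimately show ?thesis
      using inj by (simp add: matchings_def bij_betw_def comp_inj_on_iff[of _ _ fst] image_comp inj_on_imageI inj_on_subset)
  qed
  show ?thesis
    by (rule bij_betwI[where g = "(`) ?\<tau>"]) (auto simp only: inv Pi_iff intro!: *)
qed

lemma insert_matchings:
  assumes "M \<in> matchings R (C - {y})" "i \<notin> R" "y \<in> C"
  shows "insert (i, y) M \<in> matchings (insert i R) C"
  using bij_betw_matchings_Un[of "{(i, y)}" "insert i R" C] assms
  by (auto simp: bij_betw_def)

text \<open>The only cells that can be lost are \<open>(i, y)\<close> and the at most one cell of
  \<open>M\<close> in column \<open>z\<close>: column \<open>y\<close> does not occur in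
  \<open>M\<close>, and the exchange fixes all other cells.\<close>

lemma card_insert_swap_diff_le:
  assumes M: "M \<in> matchings R (C - {y})"
  shows "card (insert (i, y) M - insert (i, z) (map_prod id (Transposition.transpose y z) ` M)) \<le> 2"
proof -
  let ?Z = "{x \<in> M. snd x = z}"
  have "inj_on snd ?Z"
    by (rule inj_on_subset[OF matchings_inj(2)[OF M]]) auto
  moreover have "snd ` ?Z \<subseteq> {z}" by auto
  ultimately have Z: "finite ?Z" "card ?Z \<le> card {z}"
    using inj_on_finite[of snd ?Z "{z}"] card_inj_on_le[of snd ?Z "{z}"] by simp_all
  have "insert (i, y) M - insert (i, z) (map_prod id (Transposition.transpose y z) ` M) \<subseteq> insert (i, y) ?Z"
  proof
    fix x assume x: "x \<in> insert (i, y) M - insert (i, z) (map_prod id (Transposition.transpose y z) ` M)"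
    show "x \<in> insert (i, y) ?Z"
    proof (rule ccontr)
      assume "x \<notin> insert (i, y) ?Z"
      with x have "x \<in> M" "snd x \<noteq> z" by auto
      moreover have "snd x \<noteq> y"
        using matchings_subset[OF M] \<open>x \<in> M\<close> by auto
      ultimately have "x = map_prod id (Transposition.transpose y z) x"
        by (cases x) simp
      with x \<open>x \<in> M\<close> show False by blast
    qed
  qed
  then have "card (insert (i, y) M - insert (i, z) (map_prod id (Transposition.transpose y z) ` M))
      \<le> card (insert (i, y) ?Z)"
    using Z by (intro card_mono) auto
  also have "\<dots> \<le> Suc (card ?Z)"
    by (simp add: Z card_insert_if)
  finally show ?thesis using Z by simp
qed

text \<open>The matching is revealed row by row. Exchanging two columns turns the possible values of one row
  into each other and changes at most two cells, so Hoeffding's lemma applies at each step.\<close>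
lemma sum_exp_matchings_le:
  fixes v :: "('a \<times> 'b) set \<Rightarrow> real"
  assumes "finite R" "finite C" "card R = card C" "l > 0"
    and "\<And>M N. M \<in> matchings R C \<Longrightarrow> N \<in> matchings R C \<Longrightarrow> card (M - N) \<le> 2 \<Longrightarrow> v M - v N \<le> c"
  shows "(\<Sum>M\<in>matchings R C. exp (l * v M))
    \<le> fact (card R) * exp (l * (sum v (matchings R C) / fact (card R)) + real (card R) * (l\<^sup>2 * c\<^sup>2 / 8))"
  using assms(1-3,5)
proof (induction R arbitrary: C v rule: finite_induct)
  case empty
  then show ?case by (simp add: matchings_empty)
next
  case (insert i R)
  define r where "r = card R"
  define K where "K = l\<^sup>2 * c\<^sup>2 / 8"
  define u where "u y M = v (insert (i, y) M)" for y M
  \<comment> \<open>The conditional mean of \<open>v\<close>, given that row \<open>i\<close> is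
    matched to column \<open>y\<close>.\<close>
  define a where "a y = sum (u y) (matchings R (C - {y})) / fact r" for y
  have C: "card C = Suc r" "C \<noteq> {}"
    using insert by (auto simp: r_def)
  have cR: "card (matchings R (C - {y})) = fact r" if "y \<in> C" for y
    using that insert by (simp add: r_def card_matchings)
  have IH: "(\<Sum>M\<in>matchings R (C - {y}). exp (l * u y M)) \<le> fact r * exp (l * a y + real r * K)"
    if y: "y \<in> C" for y
    unfolding a_def r_def K_def
  proof (rule insert.IH)
    fix M N assume MN: "M \<in> matchings R (C - {y})" "N \<in> matchings R (C - {y})" "card (M - N) \<le> 2"
    have "card (insert (i, y) M - insert (i, y) N) \<le> card (M - N)"
      using finite_matching[OF insert.hyps(1) MN(1)] by (intro card_mono) auto
    with MN y insert.hyps show "u y M - u y N \<le> c"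
      unfolding u_def by (intro insert.prems insert_matchings) auto
  qed (use insert.prems C y in \<open>auto simp: r_def\<close>)
  \<comment> \<open>The conditional means are compared term by term along the column exchange, where
    each pair of matchings differs in at most two cells.\<close>
  have osc: "a y - a z \<le> c" if yz: "y \<in> C" "z \<in> C" for y z
  proof -
    let ?\<tau> = "(`) (map_prod id (Transposition.transpose y z)) :: ('a \<times> 'b) set \<Rightarrow> _"
    have bij: "bij_betw ?\<tau> (matchings R (C - {y})) (matchings R (C - {z}))"
      by (rule matchings_swap) fact+
    have "a y - a z = (\<Sum>M\<in>matchings R (C - {y}). u y M - u z (?\<tau> M)) / fact r"
      unfolding a_def sum.reindex_bij_betw[OF bij, symmetric] by (simp add: sum_subtractf diff_divide_distrib)
    also have "\<dots> \<le> (\<Sum>M\<in>matchings R (C - {y}). c) / fact r"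
    proof (intro divide_right_mono sum_mono)
      fix M assume M: "M \<in> matchings R (C - {y})"
      moreover have "?\<tau> M \<in> matchings R (C - {z})"
        using bij M by (auto simp: bij_betw_def)
      ultimately show "u y M - u z (?\<tau> M) \<le> c"
        unfolding u_def using yz insert.hyps
        by (intro insert.prems insert_matchings card_insert_swap_diff_le)
    qed simp
    also have "\<dots> = c" using cR[OF yz(1)] by simp
    finally show ?thesis .
  qed
  have "(\<Sum>M\<in>matchings (insert i R) C. exp (l * v M))
      = (\<Sum>y\<in>C. \<Sum>M\<in>matchings R (C - {y}). exp (l * u y M))"
    using insert by (simp add: sum_matchings_insert u_def)
  also have "\<dots> \<le> (\<Sum>y\<in>C. fact r * exp (l * a y + real r * K))"
    by (intro sum_mono IH)
  also have "\<dots> = fact r * exp (real r * K) * (\<Sum>y\<in>C. exp (l * a y))"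
    by (simp add: exp_add sum_distrib_left mult_ac)
  also have "\<dots> \<le> fact r * exp (real r * K) * (real (card C) * exp (l * (sum a C / real (card C)) + K))"
    unfolding K_def using insert.prems C \<open>l > 0\<close> osc by (intro mult_left_mono sum_exp_le_Hoeffding) auto
  also have "\<dots> = fact (Suc r) * exp (l * (sum a C / real (card C)) + real (Suc r) * K)"
    by (simp add: C exp_add algebra_simps)
  also have "sum a C = sum v (matchings (insert i R) C) / fact r"
    unfolding sum_matchings_insert[OF insert.hyps(1) insert.prems(1) insert.hyps(2)]
    by (simp only: a_def[abs_def] u_def[abs_def] sum_divide_distrib)
  also have "\<dots> / real (card C) = sum v (matchings (insert i R) C) / fact (Suc r)"
    by (simp add: C)
  finally show ?case
    using insert.hyps by (simp add: r_def K_def)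
qed

text \<open>Chernoff's method for \<open>- v\<close>: each member of \<open>A\<close> contributes
  exactly \<open>1\<close> to the exponential sum.\<close>

lemma card_matchings_zero_le:
  fixes v :: "('a \<times> 'b) set \<Rightarrow> real"
  assumes "finite R" "finite C" "card R = card C" "R \<noteq> {}" "c > 0" "\<mu> > 0"
    and lip: "\<And>M N. M \<in> matchings R C \<Longrightarrow> N \<in> matchings R C \<Longrightarrow> card (M - N) \<le> 2 \<Longrightarrow> v N - v M \<le> c"
    and avg: "\<mu> * fact (card R) \<le> sum v (matchings R C)"
    and A: "A \<subseteq> matchings R C" "\<And>M. M \<in> A \<Longrightarrow> v M = 0"
  shows "real (card A) \<le> fact (card R) * exp (- 2 * \<mu>\<^sup>2 / (real (card R) * c\<^sup>2))"
proof -
  define m where "m = real (card R)"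
  have m: "m > 0" using assms(1,4) by (simp add: m_def card_gt_0_iff)
  \<comment> \<open>This \<open>l\<close> minimises the exponent
    \<open>- l * \<mu> + m * (l\<^sup>2 * c\<^sup>2 / 8)\<close>.\<close>
  define l where "l = 4 * \<mu> / (m * c\<^sup>2)"
  have l: "l > 0" using m assms by (simp add: l_def)
  have fin: "finite (matchings R C)" using assms by (simp add: finite_matchings)
  have "real (card A) = (\<Sum>M\<in>A. exp (l * (- v M)))"
    using A(2) by simp
  also have "\<dots> \<le> (\<Sum>M\<in>matchings R C. exp (l * (- v M)))"
    using A(1) fin by (intro sum_mono2) auto
  also have "\<dots> \<le> fact (card R) * exp (l * ((\<Sum>M\<in>matchings R C. - v M) / fact (card R))
      + real (card R) * (l\<^sup>2 * c\<^sup>2 / 8))"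
    using assms(1-3) l lip by (intro sum_exp_matchings_le) auto
  also have "\<dots> \<le> fact (card R) * exp (l * (- \<mu>) + m * (l\<^sup>2 * c\<^sup>2 / 8))"
  proof -
    have "(\<Sum>M\<in>matchings R C. - v M) / fact (card R) \<le> - \<mu>"
      using avg by (simp add: sum_negf field_simps)
    then have "l * ((\<Sum>M\<in>matchings R C. - v M) / fact (card R)) \<le> l * (- \<mu>)"
      using l by (intro mult_left_mono) auto
    then show ?thesis
      by (simp add: m_def)
  qed
  also have "l * (- \<mu>) + m * (l\<^sup>2 * c\<^sup>2 / 8) = - 2 * \<mu>\<^sup>2 / (m * c\<^sup>2)"
    using m \<open>c > 0\<close> by (simp add: l_def field_simps power2_eq_square)
  finally show ?thesis by (simp add: m_def)
qed

section \<open>Cross-intersecting families\<close>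

lemma card_Union_degree_le:
  assumes "finite G" "finite T"
    and deg: "\<And>x. x \<in> T \<Longrightarrow> real (card {M \<in> G. x \<in> M}) \<le> d"
  shows "real (card {M \<in> G. M \<inter> T \<noteq> {}}) \<le> real (card T) * d"
proof -
  have "{M \<in> G. M \<inter> T \<noteq> {}} = (\<Union>x\<in>T. {M \<in> G. x \<in> M})" by auto
  then have "card {M \<in> G. M \<inter> T \<noteq> {}} \<le> (\<Sum>x\<in>T. card {M \<in> G. x \<in> M})"
    using card_UN_le[OF assms(2)] by simp
  then have "real (card {M \<in> G. M \<inter> T \<noteq> {}}) \<le> (\<Sum>x\<in>T. real (card {M \<in> G. x \<in> M}))"
    unfolding of_nat_sum[symmetric] of_nat_le_iff .
  also have "\<dots> \<le> real (card T) * d"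
    using deg by (rule sum_bounded_above)
  finally show ?thesis .
qed

text \<open>A union bound over the cells of \<open>T\<close> loses at most a thirtieth of
  \<open>G\<close>.\<close>

lemma card_disjoint_ge:
  assumes "finite G" "finite T"
    and deg: "\<And>x. x \<in> T \<Longrightarrow> real (card {M \<in> G. x \<in> M}) \<le> \<delta> * real (card G)"
    and small: "real (card T) * \<delta> \<le> 1 / 30"
  shows "29 / 30 * real (card G) \<le> real (card {M \<in> G. M \<inter> T = {}})"
proof -
  have "real (card {M \<in> G. M \<inter> T \<noteq> {}}) \<le> real (card T) * (\<delta> * real (card G))"
    using assms by (intro card_Union_degree_le) auto
  also have "\<dots> \<le> 1 / 30 * real (card G)"
    using mult_right_mono[OF small, of "real (card G)"] by (simp add: mult_ac)
  finally have "real (card {M \<in> G. M \<inter> T \<noteq> {}}) \<le> 1 / 30 * real (card G)" .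
  moreover have "card ({M \<in> G. M \<inter> T = {}} \<union> {M \<in> G. M \<inter> T \<noteq> {}})
      = card {M \<in> G. M \<inter> T = {}} + card {M \<in> G. M \<inter> T \<noteq> {}}"
    by (rule card_Un_disjoint) (use assms(1) in auto)
  moreover have "{M \<in> G. M \<inter> T = {}} \<union> {M \<in> G. M \<inter> T \<noteq> {}} = G" by blast
  ultimately show ?thesis by simp
qed

text \<open>\<open>K\<close> may leave the board. Only its cells on the board matter, and these
  number at most \<open>card R\<close>, as \<open>rook_ge_third\<close> demands.\<close>

lemma card_matchings_avoiding_ge:
  assumes "finite R" "finite C" "card R = card C" "card R \<ge> 3" "inj_on fst K" "inj_on snd K"
  shows "fact (card R) \<le> 3 * real (card {M \<in> matchings R C. M \<inter> K = {}})"
proof -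
  let ?K = "K \<inter> R \<times> C"
  have inj: "inj_on fst ?K" "inj_on snd ?K"
    using inj_on_subset[OF assms(5)] inj_on_subset[OF assms(6)] by auto
  have "card ?K \<le> card R"
    using inj(1) assms(1) by (intro card_inj_on_le[of fst]) auto
  moreover have "{M \<in> matchings R C. M \<inter> K = {}} = {M \<in> matchings R C. M \<inter> ?K = {}}"
    using matchings_subset[of _ R C] by blast
  ultimately have "fact (card R) \<le> 3 * int (card {M \<in> matchings R C. M \<inter> K = {}})"
    using card_matchings_avoiding[of ?K R C] inj assms(1-4) rook_ge_third[of "card ?K" "card R"]
    by simp
  then have "real_of_int (fact (card R)) \<le> real_of_int (3 * int (card {M \<in> matchings R C. M \<inter> K = {}}))"
    by (simp only: of_int_le_iff)
  then show ?thesis by simp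
qed

lemma sum_card_swap:
  assumes "finite A" "finite B"
  shows "(\<Sum>x\<in>A. real (card {y \<in> B. P x y})) = (\<Sum>y\<in>B. real (card {x \<in> A. P x y}))"
proof -
  have "(\<Sum>x\<in>A. card {y \<in> B. P x y}) = (\<Sum>y\<in>B. card {x \<in> A. P x y})"
    using assms by (intro sum_multicount_gen) simp_all
  then show ?thesis unfolding of_nat_sum[symmetric] of_nat_eq_iff .
qed

text \<open>The fraction of the members of \<open>\<G>\<^sub>2\<close> that a matching avoids is a Lipschitz function with mean
  at least \<open>1/3\<close>, but it vanishes on essentially all of \<open>\<G>\<^sub>1\<close>.\<close>
lemma cross_intersecting_card_le:
  fixes \<delta> :: real
  assumes fin: "finite R" "finite C" "card R = card C"
    and G1: "\<G>\<^sub>1 \<subseteq> {M \<in> matchings R C. S\<^sub>1 \<subseteq> M}"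
    and G2: "\<G>\<^sub>2 \<subseteq> {M \<in> matchings R C. S\<^sub>2 \<subseteq> M}" "\<G>\<^sub>2 \<noteq> {}"
    and deg1: "\<And>x. x \<notin> S\<^sub>1 \<Longrightarrow> real (card {M \<in> \<G>\<^sub>1. x \<in> M}) \<le> \<delta> * real (card \<G>\<^sub>1)"
    and deg2: "\<And>x. x \<notin> S\<^sub>2 \<Longrightarrow> real (card {M \<in> \<G>\<^sub>2. x \<in> M}) \<le> \<delta> * real (card \<G>\<^sub>2)"
    and \<delta>: "\<delta> > 0" "real (card S\<^sub>1) * \<delta> \<le> 1 / 30" "real (card S\<^sub>2) * \<delta> \<le> 1 / 30"
    and small: "card S\<^sub>1 + 3 \<le> card R"
    and cross: "\<And>A B. A \<in> \<G>\<^sub>1 \<Longrightarrow> B \<in> \<G>\<^sub>2 \<Longrightarrow> \<not> A \<inter> B \<subseteq> S\<^sub>1 \<inter> S\<^sub>2"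
  shows "29 / 30 * real (card \<G>\<^sub>1)
    \<le> fact (card R - card S\<^sub>1) * exp (- 1 / (20 * \<delta>\<^sup>2 * real (card R - card S\<^sub>1)))"
proof (cases "\<G>\<^sub>1 = {}")
  case False
  then obtain M\<^sub>1 where M1: "M\<^sub>1 \<in> matchings R C" "S\<^sub>1 \<subseteq> M\<^sub>1" using G1 by auto
  obtain M\<^sub>2 where M2: "M\<^sub>2 \<in> matchings R C" "S\<^sub>2 \<subseteq> M\<^sub>2" using G2 by auto
  have finM: "finite (matchings R C)" using fin by (simp add: finite_matchings)
  have finG: "finite \<G>\<^sub>1" "finite \<G>\<^sub>2" using G1 G2 finM by (auto intro: finite_subset)
  have finS: "finite S\<^sub>1" "finite S\<^sub>2"
    using finite_subset[OF M1(2) finite_matching[OF fin(1) M1(1)]]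
      finite_subset[OF M2(2) finite_matching[OF fin(1) M2(1)]] .
  have S1: "inj_on fst S\<^sub>1" "inj_on snd S\<^sub>1" "fst ` S\<^sub>1 \<subseteq> R" "snd ` S\<^sub>1 \<subseteq> C"
    using inj_on_subset[OF matchings_inj(1)[OF M1(1)] M1(2)] inj_on_subset[OF matchings_inj(2)[OF M1(1)] M1(2)]
      matchings_subset[OF M1(1)] M1(2) by auto
  define R' C' m where "R' = R - fst ` S\<^sub>1" and "C' = C - snd ` S\<^sub>1" and "m = card R - card S\<^sub>1"
  have fin': "finite R'" "finite C'" "card R' = m" "card C' = m"
    using fin finS S1 by (auto simp: R'_def C'_def m_def card_Diff_subset card_image)
  have m: "m \<ge> 3" using small by (simp add: m_def)
  \<comment> \<open>Members that meet the other core outside their own are discarded. For the rest,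
    disjointness of \<open>A - S\<^sub>1\<close> and \<open>B - S\<^sub>2\<close> would force
    \<open>A \<inter> B \<subseteq> S\<^sub>1 \<inter> S\<^sub>2\<close>, which \<open>cross\<close>
    excludes.\<close>
  define \<A> where "\<A> = {A \<in> \<G>\<^sub>1. A \<inter> (S\<^sub>2 - S\<^sub>1) = {}}"
  define \<B> where "\<B> = {B \<in> \<G>\<^sub>2. B \<inter> (S\<^sub>1 - S\<^sub>2) = {}}"
  have le30: "real (card (S - T)) * \<delta> \<le> 1 / 30" if "finite S" "real (card S) * \<delta> \<le> 1 / 30" for S T :: "('a \<times> 'b) set"
  proof -
    have "real (card (S - T)) * \<delta> \<le> real (card S) * \<delta>"
      using that(1) \<delta>(1) by (simp add: card_mono mult_right_mono)
    with that(2) show ?thesis by linarith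
  qed
  have cA: "29 / 30 * real (card \<G>\<^sub>1) \<le> real (card \<A>)"
    unfolding \<A>_def by (rule card_disjoint_ge[OF finG(1) _ deg1 le30]) (use finS \<delta> in auto)
  have cB: "29 / 30 * real (card \<G>\<^sub>2) \<le> real (card \<B>)"
    unfolding \<B>_def by (rule card_disjoint_ge[OF finG(2) _ deg2 le30]) (use finS \<delta> in auto)
  have finB: "finite \<B>" using finG by (simp add: \<B>_def)
  have "card \<G>\<^sub>2 > 0" using G2 finG by (simp add: card_gt_0_iff)
  with cB have B0: "real (card \<B>) > 0" by linarith
  define v where "v M = real (card {B \<in> \<B>. M \<inter> (B - S\<^sub>2) = {}}) / real (card \<B>)" for M
  \<comment> \<open>Two changed cells affect at most \<open>2 * \<delta> * card \<G>\<^sub>2\<close>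
    members, and \<open>card \<G>\<^sub>2 \<le> 30 / 29 * card \<B>\<close>.\<close>
  define c where "c = 60 / 29 * \<delta>"
  have "real (card ((\<lambda>A. A - S\<^sub>1) ` \<A>)) \<le> fact (card R') * exp (- 2 * (1 / 3)\<^sup>2 / (real (card R') * c\<^sup>2))"
  proof (rule card_matchings_zero_le[where v = v])
    show "finite R'" "finite C'" "card R' = card C'" "R' \<noteq> {}" "0 < c" "0 < (1 / 3 :: real)"
      using fin' m \<delta> by (auto simp: c_def)
    show "(\<lambda>A. A - S\<^sub>1) ` \<A> \<subseteq> matchings R' C'"
    proof (safe)
      fix A assume "A \<in> \<A>"
      then have "A \<in> {M \<in> matchings R C. S\<^sub>1 \<subseteq> M}" using G1 unfolding \<A>_def by blast
      also have "\<dots> = (\<union>) S\<^sub>1 ` matchings R' C'"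
        using bij_betw_matchings_Un[OF S1] by (simp add: bij_betw_def R'_def C'_def)
      finally obtain M where M: "M \<in> matchings R' C'" "A = S\<^sub>1 \<union> M" by auto
      moreover have "M \<inter> S\<^sub>1 = {}"
        using matchings_subset[OF M(1)] by (force simp: R'_def)
      ultimately show "A - S\<^sub>1 \<in> matchings R' C'" by (simp add: Un_Diff Diff_triv)
    qed
    show "v M = 0" if M: "M \<in> (\<lambda>A. A - S\<^sub>1) ` \<A>" for M
    proof -
      obtain A where A: "A \<in> \<A>" "M = A - S\<^sub>1" using M by auto
      have "M \<inter> (B - S\<^sub>2) \<noteq> {}" if "B \<in> \<B>" for B
      proof
        assume "M \<inter> (B - S\<^sub>2) = {}"
        with A that have "A \<inter> B \<subseteq> S\<^sub>1 \<inter> S\<^sub>2" by (auto simp: \<A>_def \<B>_def)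
        with cross[of A B] A that show False by (simp add: \<A>_def \<B>_def)
      qed
      then have "{B \<in> \<B>. M \<inter> (B - S\<^sub>2) = {}} = {}" by blast
      then show ?thesis by (simp only: v_def card.empty of_nat_0 div_0)
    qed
    show "v N - v M \<le> c" if MN: "M \<in> matchings R' C'" "N \<in> matchings R' C'" "card (M - N) \<le> 2" for M N
    proof -
      let ?T = "M - N - S\<^sub>2"
      have finT: "finite ?T" using finite_matching[OF fin'(1) MN(1)] by simp
      have T: "card ?T \<le> 2"
        using MN(3) card_mono[of "M - N" ?T] finite_matching[OF fin'(1) MN(1)] by force
      have "{B \<in> \<B>. N \<inter> (B - S\<^sub>2) = {}} \<subseteq> {B \<in> \<B>. M \<inter> (B - S\<^sub>2) = {}} \<union> {B \<in> \<G>\<^sub>2. B \<inter> ?T \<noteq> {}}"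
        by (auto simp: \<B>_def)
      then have "card {B \<in> \<B>. N \<inter> (B - S\<^sub>2) = {}}
          \<le> card ({B \<in> \<B>. M \<inter> (B - S\<^sub>2) = {}} \<union> {B \<in> \<G>\<^sub>2. B \<inter> ?T \<noteq> {}})"
        using finB finG by (intro card_mono) auto
      also have "\<dots> \<le> card {B \<in> \<B>. M \<inter> (B - S\<^sub>2) = {}} + card {B \<in> \<G>\<^sub>2. B \<inter> ?T \<noteq> {}}"
        by (rule card_Un_le)
      finally have "real (card {B \<in> \<B>. N \<inter> (B - S\<^sub>2) = {}})
          \<le> real (card {B \<in> \<B>. M \<inter> (B - S\<^sub>2) = {}}) + real (card {B \<in> \<G>\<^sub>2. B \<inter> ?T \<noteq> {}})"
        by linarith
      moreover have "real (card {B \<in> \<G>\<^sub>2. B \<inter> ?T \<noteq> {}}) \<le> real (card ?T) * (\<delta> * real (card \<G>\<^sub>2))"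
        by (rule card_Union_degree_le[OF finG(2) finT deg2]) simp
      moreover have "\<dots> \<le> 2 * (\<delta> * real (card \<G>\<^sub>2))"
        using T \<delta> by (intro mult_right_mono) auto
      moreover have "\<dots> \<le> 2 * (\<delta> * (30 / 29 * real (card \<B>)))"
        using cB \<delta> by (intro mult_left_mono) auto
      ultimately have "real (card {B \<in> \<B>. N \<inter> (B - S\<^sub>2) = {}})
          \<le> real (card {B \<in> \<B>. M \<inter> (B - S\<^sub>2) = {}}) + c * real (card \<B>)"
        by (simp add: c_def)
      then show ?thesis
        using B0 by (simp add: v_def field_simps)
    qed
    show "1 / 3 * fact (card R') \<le> sum v (matchings R' C')"
    proof -
      \<comment> \<open>Double counting of disjoint pairs: for each \<open>B\<close>, at least a
        third of the matchings of the reduced board avoid \<open>B - S\<^sub>2\<close>.\<close>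
      have "(\<Sum>B\<in>\<B>. fact m / 3) \<le> (\<Sum>B\<in>\<B>. real (card {M \<in> matchings R' C'. M \<inter> (B - S\<^sub>2) = {}}))"
      proof (rule sum_mono)
        fix B assume "B \<in> \<B>"
        then have "B \<in> matchings R C" using G2 by (auto simp: \<B>_def)
        then have "inj_on fst (B - S\<^sub>2)" "inj_on snd (B - S\<^sub>2)"
          by (auto intro: inj_on_diff dest: matchings_inj)
        then show "fact m / 3 \<le> real (card {M \<in> matchings R' C'. M \<inter> (B - S\<^sub>2) = {}})"
          using card_matchings_avoiding_ge[of R' C' "B - S\<^sub>2"] fin' m by simp
      qed
      also have "\<dots> = (\<Sum>M\<in>matchings R' C'. real (card {B \<in> \<B>. M \<inter> (B - S\<^sub>2) = {}}))"
        using finB fin' by (intro sum_card_swap) (auto simp: finite_matchings)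
      also have "\<dots> = sum v (matchings R' C') * real (card \<B>)"
        using B0 by (simp add: v_def sum_divide_distrib[symmetric])
      finally show ?thesis using B0 fin' by (simp add: field_simps)
    qed
  qed
  also have "card ((\<lambda>A. A - S\<^sub>1) ` \<A>) = card \<A>"
    using G1 by (intro card_image inj_onI) (auto simp: \<A>_def)
  finally have "real (card \<A>) \<le> fact m * exp (- 2 * (1 / 3)\<^sup>2 / (real m * c\<^sup>2))"
    using fin' by simp
  \<comment> \<open>The constant works because \<open>2 / 9 * (29 / 60)^2\<close> is about
    \<open>0.0519\<close>, above \<open>1 / 20\<close>.\<close>
  also have "\<dots> \<le> fact m * exp (- 1 / (20 * \<delta>\<^sup>2 * real m))"
    using m \<delta> by (simp add: c_def field_simps power2_eq_square)
  finally show ?thesis using cA by (simp add: m_def)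
qed simp

section \<open>Spread approximation and peeling\<close>

text \<open>\<open>S\<close> is a largest set on which the density of \<open>\<F>\<close> is at least \<open>2 ^ card S\<close> times its global density.\<close>
lemma exists_homogeneous_piece:
  fixes \<F> :: "('a \<times> 'b) set set"
  assumes fin: "finite R" "finite C" and F: "\<F> \<subseteq> matchings R C" "\<F> \<noteq> {}"
  obtains S where "{M \<in> \<F>. S \<subseteq> M} \<noteq> {}"
    and "2 ^ card S * fact (card R - card S) * real (card \<F>) \<le> real (card {M \<in> \<F>. S \<subseteq> M}) * fact (card R)"
    and "\<And>x. x \<notin> S \<Longrightarrow> real (card {M \<in> {M \<in> \<F>. S \<subseteq> M}. x \<in> M})
      \<le> 2 / real (card R - card S) * real (card {M \<in> \<F>. S \<subseteq> M})"
proof -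
  define n where "n = card R"
  define P where "P S \<longleftrightarrow> 2 ^ card S * fact (n - card S) * real (card \<F>) \<le> real (card {M \<in> \<F>. S \<subseteq> M}) * fact n" for S
  have finF: "finite \<F>" using finite_subset[OF F(1) finite_matchings[OF fin]] .
  then have F0: "card \<F> > 0" using F(2) by (simp add: card_gt_0_iff)
  have sub: "finite S \<and> card S \<le> n" if "S \<subseteq> M" "M \<in> \<F>" for S M
  proof -
    have M: "M \<in> matchings R C" using that(2) F(1) by (rule subsetD[rotated])
    show ?thesis
      using finite_matching[OF fin(1) M] card_matching[OF M] finite_subset[OF that(1)] card_mono[OF _ that(1)]
      by (simp add: n_def)
  qed
  have ne: "{M \<in> \<F>. S \<subseteq> M} \<noteq> {}" if "P S" for S
  proof
    assume "{M \<in> \<F>. S \<subseteq> M} = {}"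
    with that have "2 ^ card S * fact (n - card S) * real (card \<F>) \<le> 0" by (simp add: P_def)
    moreover have "0 < 2 ^ card S * fact (n - card S) * real (card \<F>)" using F0 by simp
    ultimately show False by linarith
  qed
  have "P {}" by (simp add: P_def)
  moreover have "card S \<le> n" if PS: "P S" for S
  proof -
    obtain M where "M \<in> \<F>" "S \<subseteq> M" using ne[OF PS] by auto
    then show ?thesis using sub by simp
  qed
  ultimately obtain S where S: "P S" and max: "\<And>S'. P S' \<Longrightarrow> card S' \<le> card S"
    using ex_has_greatest_nat[of P "{}" card "Suc n"] by (auto simp: less_Suc_eq_le)
  show thesis
  proof (rule that)
    show "{M \<in> \<F>. S \<subseteq> M} \<noteq> {}" using ne S .
    show "2 ^ card S * fact (card R - card S) * real (card \<F>) \<le> real (card {M \<in> \<F>. S \<subseteq> M}) * fact (card R)"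
      using S by (simp add: P_def n_def)
    fix x assume x: "x \<notin> S"
    define g where "g = real (card {M \<in> \<F>. S \<subseteq> M})"
    define h where "h = real (card {M \<in> \<F>. insert x S \<subseteq> M})"
    have "h \<le> 2 / real (n - card S) * g"
    proof (cases "{M \<in> \<F>. insert x S \<subseteq> M} = {}")
      case False
      then obtain M where "M \<in> \<F>" "insert x S \<subseteq> M" by auto
      then have s: "finite S" "card (insert x S) \<le> n" using sub[of "insert x S" M] by simp_all
      then have s': "card (insert x S) = Suc (card S)" "card S < n" using x by auto
      \<comment> \<open>Maximality makes the density condition fail for \<open>insert x S\<close>
        while it holds for \<open>S\<close>. Comparing the two bounds the share of members through
        \<open>x\<close>; the factor \<open>n - card S\<close> restores the factorial.\<close>
      then have "\<not> P (insert x S)" using max by force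
      then have "h * fact n < 2 ^ Suc (card S) * fact (n - Suc (card S)) * real (card \<F>)"
        using s' by (simp add: P_def h_def)
      then have "real (n - card S) * (h * fact n)
          \<le> real (n - card S) * (2 ^ Suc (card S) * fact (n - Suc (card S)) * real (card \<F>))"
        by (intro mult_left_mono) auto
      also have "\<dots> = 2 * (2 ^ card S * (real (n - card S) * fact (n - card S - 1)) * real (card \<F>))"
        by simp
      also have "real (n - card S) * fact (n - card S - 1) = fact (n - card S)"
        using s' fact_reduce[of "n - card S", where 'a = real] by simp
      also have "2 * (2 ^ card S * fact (n - card S) * real (card \<F>)) \<le> 2 * (g * fact n)"
        using S by (simp add: P_def g_def)
      finally have "(real (n - card S) * h) * fact n \<le> (2 * g) * fact n" by (simp add: mult_ac)
      then have "real (n - card S) * h \<le> 2 * g" by simp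
      then show ?thesis using s' by (simp add: field_simps)
    next
      case True
      show ?thesis unfolding h_def True by (simp add: g_def)
    qed
    moreover have "{M \<in> {M \<in> \<F>. S \<subseteq> M}. x \<in> M} = {M \<in> \<F>. insert x S \<subseteq> M}" by auto
    ultimately show "real (card {M \<in> {M \<in> \<F>. S \<subseteq> M}. x \<in> M})
      \<le> 2 / real (card R - card S) * real (card {M \<in> \<F>. S \<subseteq> M})"
      by (simp only: h_def g_def n_def)
  qed
qed

section \<open>Branching, minimal refinements and peeling\<close>

text \<open>A proper subset \<open>A\<close> of a member of \<open>\<W>\<close> meets some
  \<open>U\<close> in fewer than \<open>t\<close> points, whereas every member of
  \<open>\<W>\<close> meets \<open>U\<close> in at least \<open>t\<close>. So each member containing
  \<open>A\<close> also contains a point of \<open>U - A\<close>: at most \<open>k\<close> choices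
  for each of the \<open>j\<close> points still to be found.\<close>

lemma card_superset_branching_le:
  fixes \<U> \<W> :: "'a set set"
  assumes finU: "\<And>U. U \<in> \<U> \<Longrightarrow> finite U \<and> card U \<le> k"
    and finW: "finite \<W>" "\<And>W. W \<in> \<W> \<Longrightarrow> finite W \<and> card W = k"
    and int: "\<And>U W. U \<in> \<U> \<Longrightarrow> W \<in> \<W> \<Longrightarrow> t \<le> card (U \<inter> W)"
    and min: "\<And>W X. W \<in> \<W> \<Longrightarrow> X \<subset> W \<Longrightarrow> \<exists>U\<in>\<U>. card (X \<inter> U) < t"
    and A: "finite A" "card A + j = k"
  shows "card {W \<in> \<W>. A \<subseteq> W} \<le> k ^ j"
  using A
proof (induction j arbitrary: A)
  case 0
  have "W = A" if "W \<in> \<W>" "A \<subseteq> W" for W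
    using that 0 finW(2)[of W] card_subset_eq[of W A] by auto
  then have "{W \<in> \<W>. A \<subseteq> W} \<subseteq> {A}" by auto
  from card_mono[OF _ this] show ?case by simp
next
  case (Suc j)
  show ?case
  proof (cases "{W \<in> \<W>. A \<subseteq> W} = {}")
    case False
    then obtain W where W: "W \<in> \<W>" "A \<subseteq> W" by auto
    then have "A \<subset> W" using finW(2)[of W] Suc.prems by auto
    from min[OF W(1) this] obtain U where U: "U \<in> \<U>" "card (A \<inter> U) < t" by auto
    have "{W \<in> \<W>. A \<subseteq> W} \<subseteq> (\<Union>x\<in>U - A. {W \<in> \<W>. insert x A \<subseteq> W})"
    proof
      fix V assume V: "V \<in> {W \<in> \<W>. A \<subseteq> W}"
      have "\<not> U \<inter> V \<subseteq> A \<inter> U"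
        using card_mono[of "A \<inter> U" "U \<inter> V"] int[OF U(1)] V U(2) Suc.prems by force
      with V show "V \<in> (\<Union>x\<in>U - A. {W \<in> \<W>. insert x A \<subseteq> W})" by auto
    qed
    then have "card {W \<in> \<W>. A \<subseteq> W} \<le> card (\<Union>x\<in>U - A. {W \<in> \<W>. insert x A \<subseteq> W})"
      using finW finU U by (intro card_mono) auto
    also have "\<dots> \<le> (\<Sum>x\<in>U - A. card {W \<in> \<W>. insert x A \<subseteq> W})"
      using finU U by (intro card_UN_le) auto
    also have "\<dots> \<le> (\<Sum>x\<in>U - A. k ^ j)"
      using Suc.prems by (intro sum_mono Suc.IH) auto
    also have "\<dots> \<le> k * k ^ j"
      using finU[OF U(1)] card_mono[of U "U - A"] by simp
    finally show ?thesis by simp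
  next
    case True
    show ?thesis unfolding True by simp
  qed
qed

text \<open>A family of this kind with least total size \<open>sum card \<U>\<close> is minimal.\<close>
lemma exists_minimal_t_intersecting:
  assumes fin: "finite \<S>" "\<And>S. S \<in> \<S> \<Longrightarrow> finite S" and int: "t_intersecting t \<S>"
  obtains \<U> where "finite \<U>" "\<And>U. U \<in> \<U> \<Longrightarrow> \<exists>S\<in>\<S>. U \<subseteq> S" "\<And>S. S \<in> \<S> \<Longrightarrow> \<exists>U\<in>\<U>. U \<subseteq> S"
    "t_intersecting t \<U>" "\<And>W X. W \<in> \<U> \<Longrightarrow> X \<subset> W \<Longrightarrow> \<exists>U\<in>\<U>. card (X \<inter> U) < t"
proof -
  define P where "P \<U> \<longleftrightarrow> (\<forall>U\<in>\<U>. \<exists>S\<in>\<S>. U \<subseteq> S) \<and> (\<forall>S\<in>\<S>. \<exists>U\<in>\<U>. U \<subseteq> S) \<and> t_intersecting t \<U>" for \<U>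
  have "P \<S>" using int by (auto simp: P_def)
  then obtain \<U> where U: "P \<U>" and least: "\<And>\<V>. P \<V> \<Longrightarrow> sum card \<U> \<le> sum card \<V>"
    using ex_has_least_nat[of P \<S> "sum card"] by blast
  have "\<U> \<subseteq> Pow (\<Union>\<S>)" using U unfolding P_def by blast
  moreover have "finite (Pow (\<Union>\<S>))" using fin by simp
  ultimately have finU: "finite \<U>" by (rule finite_subset)
  have min: "\<exists>U\<in>\<U>. card (X \<inter> U) < t" if W: "W \<in> \<U>" and X: "X \<subset> W" for W X
  proof (rule ccontr)
    assume "\<not> (\<exists>U\<in>\<U>. card (X \<inter> U) < t)"
    then have *: "t \<le> card (X \<inter> U)" if "U \<in> \<U>" for U using that by force
    \<comment> \<open>Replacing \<open>W\<close> by its proper subset \<open>X\<close> would keep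
      all three properties in \<open>P\<close> and lower the total size.\<close>
    let ?V = "insert X (\<U> - {W})"
    obtain S where "S \<in> \<S>" "W \<subseteq> S" using W U by (auto simp: P_def)
    then have "finite W" using fin(2) finite_subset by blast
    have "t \<le> card X"
      using *[OF W] X by (simp add: Int_absorb2 psubset_imp_subset)
    with * U have "t_intersecting t ?V"
      by (auto simp: t_intersecting_def P_def Int_commute)
    moreover have "\<exists>V\<in>?V. V \<subseteq> S'" if S': "S' \<in> \<S>" for S'
    proof -
      obtain U where "U \<in> \<U>" "U \<subseteq> S'" using U S' unfolding P_def by blast
      then show ?thesis using X by (cases "U = W") auto
    qed
    moreover have "\<exists>S\<in>\<S>. V \<subseteq> S" if V: "V \<in> ?V" for V
    proof (cases "V = X")
      case True
      then show ?thesis using \<open>S \<in> \<S>\<close> \<open>W \<subseteq> S\<close> X by blast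
    next
      case False
      then have "V \<in> \<U>" using V by simp
      then show ?thesis using U unfolding P_def by blast
    qed
    ultimately have "P ?V" unfolding P_def by blast
    from least[OF this] have "sum card \<U> \<le> sum card ?V" .
    also have "\<dots> \<le> card X + sum card (\<U> - {W})"
      using finU by (simp add: sum.insert_if)
    also have "\<dots> < card W + sum card (\<U> - {W})"
      using psubset_card_mono[OF \<open>finite W\<close> X] by simp
    also have "\<dots> = sum card \<U>"
      using finU W by (simp add: sum.remove)
    finally show False by simp
  qed
  show thesis
    by (rule that[OF finU _ _ _ min]) (use U in \<open>auto simp: P_def\<close>)
qed

text \<open>In a minimal refinement the members of full size \<open>k\<close> are split off as
  \<open>\<W>\<close>. All of them share a \<open>t\<close>-set with one fixed member, which gives
  \<open>k choose t\<close> starting points for the branching bound.\<close>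

lemma peel_step:
  assumes fin: "finite \<S>" "\<And>S. S \<in> \<S> \<Longrightarrow> finite S \<and> card S \<le> k" and int: "t_intersecting t \<S>"
    and "t \<le> k"
  obtains \<T> \<W> where "finite \<T>" "finite \<W>" "\<And>U. U \<in> \<T> \<Longrightarrow> (\<exists>S\<in>\<S>. U \<subseteq> S) \<and> card U < k"
    "\<And>S. S \<in> \<S> \<Longrightarrow> \<exists>U\<in>\<T> \<union> \<W>. U \<subseteq> S" "t_intersecting t \<T>"
    "\<And>W. W \<in> \<W> \<Longrightarrow> card W = k" "card \<W> \<le> (k choose t) * k ^ (k - t)"
proof -
  have finS: "\<And>S. S \<in> \<S> \<Longrightarrow> finite S" using fin(2) by blast
  obtain \<U> where U: "finite \<U>" "\<And>U. U \<in> \<U> \<Longrightarrow> \<exists>S\<in>\<S>. U \<subseteq> S" "\<And>S. S \<in> \<S> \<Longrightarrow> \<exists>U\<in>\<U>. U \<subseteq> S"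
    "t_intersecting t \<U>" "\<And>W X. W \<in> \<U> \<Longrightarrow> X \<subset> W \<Longrightarrow> \<exists>U\<in>\<U>. card (X \<inter> U) < t"
    by (rule exists_minimal_t_intersecting[OF fin(1) finS int]; (assumption | (rule that; assumption)))
  have finU: "finite U \<and> card U \<le> k" if "U \<in> \<U>" for U
    using U(2)[OF that] fin(2) finite_subset card_mono order_trans by metis
  define \<W> where "\<W> = {W \<in> \<U>. card W = k}"
  have count: "card {W \<in> \<W>. A \<subseteq> W} \<le> k ^ (k - t)" if "finite A" "card A = t" for A
  proof (rule card_superset_branching_le[of \<U> k \<W> t])
    show "finite \<W>" using U(1) by (simp add: \<W>_def)
    show "t \<le> card (U \<inter> W)" if "U \<in> \<U>" "W \<in> \<W>" for U W
      using that U(4) by (simp add: \<W>_def t_intersecting_def)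
    show "\<exists>U\<in>\<U>. card (X \<inter> U) < t" if "W \<in> \<W>" "X \<subset> W" for W X
      using U(5)[OF _ that(2)] that(1) by (simp add: \<W>_def)
  qed (use finU that \<open>t \<le> k\<close> in \<open>simp_all add: \<W>_def\<close>)
  have "card \<W> \<le> (k choose t) * k ^ (k - t)"
  proof (cases "\<W> = {}")
    case False
    then obtain W where W: "W \<in> \<W>" by auto
    then have fW: "finite W" "card W = k" using finU by (auto simp: \<W>_def)
    let ?\<A> = "{A. A \<subseteq> W \<and> card A = t}"
    have "\<W> \<subseteq> (\<Union>A\<in>?\<A>. {W \<in> \<W>. A \<subseteq> W})"
    proof
      fix V assume V: "V \<in> \<W>"
      with W U(4) have "t \<le> card (W \<inter> V)" by (auto simp: \<W>_def t_intersecting_def)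
      then obtain A where "A \<subseteq> W \<inter> V" "card A = t" by (meson obtain_subset_with_card_n)
      with V show "V \<in> (\<Union>A\<in>?\<A>. {W \<in> \<W>. A \<subseteq> W})" by auto
    qed
    then have "card \<W> \<le> card (\<Union>A\<in>?\<A>. {W \<in> \<W>. A \<subseteq> W})"
      using fW U(1) by (intro card_mono) (auto simp: \<W>_def)
    also have "\<dots> \<le> (\<Sum>A\<in>?\<A>. card {W \<in> \<W>. A \<subseteq> W})"
      using fW by (intro card_UN_le) auto
    also have "\<dots> \<le> (\<Sum>A\<in>?\<A>. k ^ (k - t))"
      using fW(1) by (intro sum_mono count) (auto simp: finite_subset[of _ W])
    also have "\<dots> = (k choose t) * k ^ (k - t)"
      using fW n_subsets[of W t] by simp
    finally show ?thesis .
  qed simp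
  moreover have "t_intersecting t {U \<in> \<U>. card U < k}"
    using U(4) by (simp add: t_intersecting_def)
  moreover have "\<exists>V\<in>{U \<in> \<U>. card U < k} \<union> \<W>. V \<subseteq> S" if S: "S \<in> \<S>" for S
  proof -
    obtain V where V: "V \<in> \<U>" "V \<subseteq> S" using U(3)[OF S] ..
    then have "V \<in> {U \<in> \<U>. card U < k} \<union> \<W>" using finU[OF V(1)] by (auto simp: \<W>_def)
    with V(2) show ?thesis by blast
  qed
  moreover have "finite {U \<in> \<U>. card U < k}" "finite \<W>" using U(1) by (simp_all add: \<W>_def)
  moreover have "(\<exists>S\<in>\<S>. V \<subseteq> S) \<and> card V < k" if "V \<in> {U \<in> \<U>. card U < k}" for V
    using that U(2)[of V] by simp
  moreover have "card W = k" if "W \<in> \<W>" for W using that by (simp add: \<W>_def)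
  ultimately show thesis by (intro that[of "{U \<in> \<U>. card U < k}" \<W>])
qed

text \<open>Sizes are peeled from the top, one per induction step, down to \<open>b\<close>. The
  weight \<open>f k\<close> will be \<open>fact (n - k)\<close>, the bound on the number of
  matchings through a discarded set of size \<open>k\<close>.\<close>

lemma peel:
  fixes f :: "nat \<Rightarrow> nat"
  assumes "finite \<S>" "\<And>S. S \<in> \<S> \<Longrightarrow> finite S \<and> card S \<le> q" "t_intersecting t \<S>"
    and "t \<le> b" "b \<le> q"
  shows "\<exists>\<T> \<W>. finite \<T> \<and> finite \<W> \<and> (\<forall>U\<in>\<T>. (\<exists>S\<in>\<S>. U \<subseteq> S) \<and> card U \<le> b)
    \<and> (\<forall>S\<in>\<S>. \<exists>U\<in>\<T> \<union> \<W>. U \<subseteq> S) \<and> t_intersecting t \<T>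
    \<and> (\<Sum>W\<in>\<W>. f (card W)) \<le> (\<Sum>k\<in>{b<..q}. (k choose t) * k ^ (k - t) * f k)"
  using assms(5,1-3)
proof (induction q arbitrary: \<S> rule: dec_induct)
  case base
  then show ?case by (intro exI[of _ \<S>] exI[of _ "{}"]) auto
next
  case (step q)
  have tq: "t \<le> Suc q" using step.hyps assms(4) by simp
  obtain \<T>\<^sub>1 \<W>\<^sub>1 where 1: "finite \<T>\<^sub>1" "finite \<W>\<^sub>1" "\<And>U. U \<in> \<T>\<^sub>1 \<Longrightarrow> (\<exists>S\<in>\<S>. U \<subseteq> S) \<and> card U < Suc q"
    "\<And>S. S \<in> \<S> \<Longrightarrow> \<exists>U\<in>\<T>\<^sub>1 \<union> \<W>\<^sub>1. U \<subseteq> S" "t_intersecting t \<T>\<^sub>1"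
    "\<And>W. W \<in> \<W>\<^sub>1 \<Longrightarrow> card W = Suc q" "card \<W>\<^sub>1 \<le> (Suc q choose t) * Suc q ^ (Suc q - t)"
    by (rule peel_step[OF step.prems(1,2,3) tq]; (assumption | (rule that; assumption)))
  have "finite U \<and> card U \<le> q" if "U \<in> \<T>\<^sub>1" for U
    using 1(3)[OF that] step.prems(2) finite_subset by (auto simp: less_Suc_eq_le)
  from step.IH[OF 1(1) this 1(5)] obtain \<T> \<W> where 2: "finite \<T>" "finite \<W>"
    "\<forall>U\<in>\<T>. (\<exists>S\<in>\<T>\<^sub>1. U \<subseteq> S) \<and> card U \<le> b"
    "\<forall>S\<in>\<T>\<^sub>1. \<exists>U\<in>\<T> \<union> \<W>. U \<subseteq> S" "t_intersecting t \<T>"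
    "(\<Sum>W\<in>\<W>. f (card W)) \<le> (\<Sum>k\<in>{b<..q}. (k choose t) * k ^ (k - t) * f k)"
    by auto
  have "(\<Sum>W\<in>\<W> \<union> \<W>\<^sub>1. f (card W)) \<le> (\<Sum>W\<in>\<W>. f (card W)) + (\<Sum>W\<in>\<W>\<^sub>1. f (card W))"
    using 1(2) 2(2) by (simp add: sum_Un_nat)
  also have "(\<Sum>W\<in>\<W>\<^sub>1. f (card W)) = card \<W>\<^sub>1 * f (Suc q)"
    using 1(6) by simp
  also have "\<dots> \<le> (Suc q choose t) * Suc q ^ (Suc q - t) * f (Suc q)"
    using 1(7) by (intro mult_right_mono) auto
  also have "(\<Sum>W\<in>\<W>. f (card W)) + \<dots> \<le> (\<Sum>k\<in>{b<..Suc q}. (k choose t) * k ^ (k - t) * f k)"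
  proof -
    have "{b<..Suc q} = insert (Suc q) {b<..q}" using step.hyps by auto
    then show ?thesis using 2(6) by simp
  qed
  finally have "(\<Sum>W\<in>\<W> \<union> \<W>\<^sub>1. f (card W)) \<le> (\<Sum>k\<in>{b<..Suc q}. (k choose t) * k ^ (k - t) * f k)" by simp
  moreover have "\<exists>U\<in>\<T> \<union> (\<W> \<union> \<W>\<^sub>1). U \<subseteq> S" if S: "S \<in> \<S>" for S
  proof -
    obtain V where V: "V \<in> \<T>\<^sub>1 \<union> \<W>\<^sub>1" "V \<subseteq> S" using 1(4)[OF S] ..
    show ?thesis
    proof (cases "V \<in> \<W>\<^sub>1")
      case False
      with V 2(4) obtain U where "U \<in> \<T> \<union> \<W>" "U \<subseteq> V" by blast
      with V(2) show ?thesis by blast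
    qed (use V in blast)
  qed
  moreover have "\<exists>S\<in>\<S>. U \<subseteq> S" if "U \<in> \<T>" for U
  proof -
    obtain V where "V \<in> \<T>\<^sub>1" "U \<subseteq> V" using 2(3) \<open>U \<in> \<T>\<close> by blast
    with 1(3)[of V] show ?thesis by blast
  qed
  ultimately show ?case
    using 1(2) 2(1-3,5) by (intro exI[of _ \<T>] exI[of _ "\<W> \<union> \<W>\<^sub>1"]) simp
qed

section \<open>The kernel of a t-intersecting family\<close>

lemma size_bound:
  fixes n t :: nat
  assumes "t \<ge> 1" "n \<ge> 130 * (t + 1) * (8 * t) ^ t"
  shows "2080 * t\<^sup>2 \<le> n"
\<comment> \<open>For \<open>t = 1\<close> the hypothesis reads exactly
  \<open>n \<ge> 130 * 2 * 8 = 2080\<close>; from \<open>t = 2\<close> on the power alone supplies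
  \<open>64 * t\<^sup>2\<close>.\<close>
proof (cases "t = 1")
  case False
  have "(8 * t)\<^sup>2 \<le> (8 * t) ^ t"
    using assms False by (intro power_increasing) auto
  then have "130 * 1 * (8 * t)\<^sup>2 \<le> 130 * (t + 1) * (8 * t) ^ t"
    by (intro mult_mono) auto
  then show ?thesis using assms by (simp add: power_mult_distrib)
qed (use assms in simp)

lemma ln_2080: "ln (2080 :: real) \<le> 766 / 100"
proof -
  have "ln (2080 :: real) = ln (2 ^ 11 * (1 + 1 / 64))" by simp
  also have "\<dots> = ln (2 ^ 11) + ln (1 + 1 / 64)" by (rule ln_mult_pos) simp_all
  also have "\<dots> = 11 * ln 2 + ln (1 + 1 / 64)" by (subst ln_realpow) simp_all
  also have "\<dots> \<le> 11 * (25 / 36) + 1 / 64"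
    using ln2_le_25_over_36 ln_add_one_self_le_self[of "1 / 64 :: real"] by (intro add_mono) auto
  finally show ?thesis by simp
qed

lemma ln_bound:
  fixes n t :: nat
  assumes "t \<ge> 1" "2080 * t\<^sup>2 \<le> n"
  shows "2 * real t * ln (real n) \<le> real n / 130"
proof -
  \<comment> \<open>Normalised so that \<open>z \<ge> t\<close> and
    \<open>n = 2080 * z\<^sup>2\<close>. The logarithm is then linear in \<open>z\<close>, and
    \<open>2080 / 130 = 16\<close> leaves room for \<open>4 * z\<^sup>2\<close> plus a linear
    term.\<close>
  define z where "z = sqrt (real n / 2080)"
  have "2080 * (real t)\<^sup>2 \<le> real n"
    using assms(2) by (metis of_nat_le_iff of_nat_mult of_nat_numeral of_nat_power)
  then have t: "real t \<le> z" by (simp add: z_def real_le_rsqrt)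
  then have z: "z \<ge> 1" using assms(1) by simp
  have n: "real n = 2080 * z\<^sup>2" by (simp add: z_def)
  have "ln (real n) = ln 2080 + 2 * ln z"
    unfolding n using z by (subst ln_mult) (simp_all add: ln_realpow)
  also have "\<dots> \<le> 766 / 100 + 2 * (z - 1)"
    using ln_2080 ln_le_minus_one[of z] z by (intro add_mono) auto
  finally have "ln (real n) \<le> 566 / 100 + 2 * z" by simp
  moreover have "1 \<le> z\<^sup>2" using z by (simp add: one_le_power)
  then have "0 \<le> ln (real n)" by (simp add: n)
  ultimately have "2 * real t * ln (real n) \<le> 2 * z * (566 / 100 + 2 * z)"
    using t z by (intro mult_mono) auto
  also have "\<dots> \<le> 16 * z\<^sup>2"
    using z mult_left_mono[of 1 z z] by (simp add: power2_eq_square algebra_simps)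
  also have "\<dots> = real n / 130" by (simp add: n)
  finally show ?thesis .
qed

lemma ln_16: "ln (16 :: real) \<le> 100 / 36"
proof -
  have "ln (16 :: real) = ln (2 ^ 4)" by simp
  also have "\<dots> = 4 * ln 2" by (subst ln_realpow) simp_all
  finally show ?thesis using ln2_le_25_over_36 by simp
qed

text \<open>With 10 raised to 16, logarithms give
  \<open>s \<le> 3 / 2 * (100 / 36 + n / 130)\<close>, which is below \<open>n / 70\<close> from
  2080 on.\<close>

lemma spread_piece_size:
  fixes n t s :: nat
  assumes "2080 \<le> n" "2 * real t * ln (real n) \<le> real n / 130" "2 ^ s \<le> 10 * real n ^ (2 * t)"
  shows "70 * s \<le> n"
proof -
  have "real s * ln 2 = ln (2 ^ s)" by (simp add: ln_realpow)
  also have "\<dots> \<le> ln (16 * real n ^ (2 * t))"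
    using assms(1,3) by (subst ln_le_cancel_iff) (auto intro: order_trans)
  also have "\<dots> = ln 16 + 2 * real t * ln (real n)"
    using assms(1) by (subst ln_mult) (simp_all add: ln_realpow)
  also have "\<dots> \<le> 100 / 36 + real n / 130"
    using ln_16 assms(2) by simp
  finally have "real s * ln 2 \<le> 100 / 36 + real n / 130" .
  moreover have "real s * (2 / 3) \<le> real s * ln 2"
    using ln2_ge_two_thirds by (intro mult_left_mono) auto
  ultimately have "real s * (2 / 3) \<le> 100 / 36 + real n / 130" by linarith
  moreover have "2080 \<le> real n" using assms(1) by simp
  ultimately have "70 * real s \<le> real n" by linarith
  then show ?thesis by linarith
qed

text \<open>The concentration bound has exponent \<open>n / 83\<close>, against the polynomial loss
  of at most \<open>n / 130\<close> in logarithmic scale. The gap absorbs \<open>ln 16\<close>, and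
  16 exceeds \<open>300 / 29\<close>.\<close>

lemma exp_lt_inverse_power:
  fixes n t :: nat
  assumes "2080 \<le> n" "2 * real t * ln (real n) \<le> real n / 130"
  shows "exp (- (real n / 83)) < 29 / 30 * (1 / (10 * real n ^ (2 * t)))"
proof -
  have "2080 \<le> real n" using assms(1) by simp
  with ln_16 assms(2) have "ln 16 + 2 * real t * ln (real n) < real n / 83" by linarith
  then have "exp (- (real n / 83)) < exp (- (ln 16 + 2 * real t * ln (real n)))" by simp
  also have "\<dots> = inverse (exp (ln 16) * exp (2 * real t * ln (real n)))"
    by (simp only: exp_minus exp_add)
  also have "\<dots> = 1 / (16 * exp (ln (real n) * real (2 * t)))"
    by (simp add: inverse_eq_divide mult_ac)
  also have "exp (ln (real n) * real (2 * t)) = real n ^ (2 * t)"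
    using assms(1) exp_of_nat2_mult[of "ln (real n)" "2 * t"] by simp
  also have "1 / (16 * real n ^ (2 * t)) \<le> 29 / 30 * (1 / (10 * real n ^ (2 * t)))"
    using assms(1) by (simp add: divide_simps)
  finally show ?thesis .
qed

lemma fact_le_power_mult_fact:
  assumes "k \<le> n"
  shows "(fact n :: real) \<le> real n ^ k * fact (n - k)"
  using assms
proof (induction k)
  case (Suc k)
  then have "fact n \<le> real n ^ k * fact (n - k)" by simp
  also have "fact (n - k) = real (n - k) * fact (n - Suc k)"
    using Suc.prems fact_reduce[of "n - k", where 'a = real] by simp
  also have "real n ^ k * \<dots> \<le> real n ^ k * (real n * fact (n - Suc k))"
    by (intro mult_left_mono mult_right_mono) auto
  finally show ?case by (simp add: mult_ac)
qed simp

text \<open>\<open>\<S>\<close> consists of all small cores that carry a homogeneous and not too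
  small part of \<open>\<F>\<close>. Two cores sharing fewer than \<open>t\<close> cells would
  contradict the cross-intersecting bound; a large uncovered part would itself contain a homogeneous
  piece, hence a core.\<close>

lemma spread_approximation:
  fixes n t :: nat
  defines "\<Sigma> \<equiv> matchings {1..n} {1..n}"
  assumes n: "2080 \<le> n" "2 * t \<le> n" "2 * real t * ln (real n) \<le> real n / 130"
    and F: "\<F> \<subseteq> \<Sigma>" "t_intersecting t \<F>"
  obtains \<S> where "\<And>S. S \<in> \<S> \<Longrightarrow> \<exists>M\<in>\<F>. S \<subseteq> M" "\<And>S. S \<in> \<S> \<Longrightarrow> 70 * card S \<le> n"
    "t_intersecting t \<S>" "real (card {M \<in> \<F>. \<forall>S\<in>\<S>. \<not> S \<subseteq> M}) \<le> 1 / 10 * fact (n - 2 * t)"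
proof -
  \<comment> \<open>If the uncovered part exceeds \<open>fact (n - 2 * t) / 10\<close>, its density
    in all matchings is at least \<open>1 / N\<close>.\<close>
  define N where "N = 10 * real n ^ (2 * t)"
  define hom where "hom S \<G> \<longleftrightarrow> \<G> \<noteq> {} \<and> \<G> \<subseteq> {M \<in> \<F>. S \<subseteq> M} \<and> fact (n - card S) / N \<le> real (card \<G>)
      \<and> (\<forall>x. x \<notin> S \<longrightarrow> real (card {M \<in> \<G>. x \<in> M}) \<le> 2 / real (n - card S) * real (card \<G>))" for S \<G>
  define \<S> where "\<S> = {S. 70 * card S \<le> n \<and> (\<exists>\<G>. hom S \<G>)}"
  have finS: "finite \<Sigma>" unfolding \<Sigma>_def by (simp add: finite_matchings)
  have N: "N > 0" using n by (simp add: N_def)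
  show thesis
  proof (rule that)
    show "\<exists>M\<in>\<F>. S \<subseteq> M" "70 * card S \<le> n" if "S \<in> \<S>" for S
      using that by (auto simp: \<S>_def hom_def)
    show "t_intersecting t \<S>"
      unfolding t_intersecting_def
    proof (intro ballI, rule ccontr)
      fix S\<^sub>1 S\<^sub>2 assume S: "S\<^sub>1 \<in> \<S>" "S\<^sub>2 \<in> \<S>" and lt: "\<not> t \<le> card (S\<^sub>1 \<inter> S\<^sub>2)"
      obtain \<G>\<^sub>1 where G1: "hom S\<^sub>1 \<G>\<^sub>1" using S(1) by (auto simp: \<S>_def)
      obtain \<G>\<^sub>2 where G2: "hom S\<^sub>2 \<G>\<^sub>2" using S(2) by (auto simp: \<S>_def)
      \<comment> \<open>The value of \<open>2 / (n - s)\<close> at \<open>s = n / 70\<close>, the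
        largest core size allowed; \<open>s * \<delta>\<close> is then at most
        \<open>2 / 69\<close>.\<close>
      define \<delta> where "\<delta> = 140 / (69 * real n)"
      have \<delta>: "\<delta> > 0" using n by (simp add: \<delta>_def)
      have small: "real (card S) * \<delta> \<le> 1 / 30" "2 / real (n - card S) \<le> \<delta>" if "S \<in> \<S>" for S
      proof -
        have s: "70 * real (card S) \<le> real n" using that by (simp add: \<S>_def)
        then show "real (card S) * \<delta> \<le> 1 / 30" using n by (simp add: \<delta>_def field_simps)
        have "real (n - card S) = real n - real (card S)" using s by linarith
        then show "2 / real (n - card S) \<le> \<delta>" using s n by (simp add: \<delta>_def field_simps)
      qed
      have deg: "real (card {M \<in> \<G>. x \<in> M}) \<le> \<delta> * real (card \<G>)" if "S \<in> \<S>" "hom S \<G>" "x \<notin> S" for S \<G> x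
      proof -
        have "real (card {M \<in> \<G>. x \<in> M}) \<le> 2 / real (n - card S) * real (card \<G>)"
          using that(2,3) unfolding hom_def by blast
        also have "\<dots> \<le> \<delta> * real (card \<G>)"
          using small(2)[OF that(1)] by (intro mult_right_mono) auto
        finally show ?thesis .
      qed
      have s1: "70 * card S\<^sub>1 \<le> n" using S(1) by (simp add: \<S>_def)
      define m where "m = real (n - card S\<^sub>1)"
      have m: "m > 0" "m \<le> real n" using s1 n by (auto simp: m_def)
      have "29 / 30 * real (card \<G>\<^sub>1)
          \<le> fact (card {1..n} - card S\<^sub>1) * exp (- 1 / (20 * \<delta>\<^sup>2 * real (card {1..n} - card S\<^sub>1)))"
      proof (rule cross_intersecting_card_le[where C = "{1..n}" and \<G>\<^sub>2 = \<G>\<^sub>2 and S\<^sub>2 = S\<^sub>2])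
        show "\<G>\<^sub>1 \<subseteq> {M \<in> matchings {1..n} {1..n}. S\<^sub>1 \<subseteq> M}" "\<G>\<^sub>2 \<subseteq> {M \<in> matchings {1..n} {1..n}. S\<^sub>2 \<subseteq> M}" "\<G>\<^sub>2 \<noteq> {}"
          using G1 G2 F(1) unfolding hom_def \<Sigma>_def by blast+
        show "real (card {M \<in> \<G>\<^sub>1. x \<in> M}) \<le> \<delta> * real (card \<G>\<^sub>1)" if "x \<notin> S\<^sub>1" for x
          by (rule deg[OF S(1) G1 that])
        show "real (card {M \<in> \<G>\<^sub>2. x \<in> M}) \<le> \<delta> * real (card \<G>\<^sub>2)" if "x \<notin> S\<^sub>2" for x
          by (rule deg[OF S(2) G2 that])
        show "card S\<^sub>1 + 3 \<le> card {1..n}" using s1 n by simp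
        show "\<not> A \<inter> B \<subseteq> S\<^sub>1 \<inter> S\<^sub>2" if AB: "A \<in> \<G>\<^sub>1" "B \<in> \<G>\<^sub>2" for A B
        proof
          assume "A \<inter> B \<subseteq> S\<^sub>1 \<inter> S\<^sub>2"
          have AB': "A \<in> \<F>" "B \<in> \<F>" "S\<^sub>1 \<subseteq> A" using AB G1 G2 unfolding hom_def by blast+
          then have "A \<in> \<Sigma>" using F(1) by blast
          then have "finite A" unfolding \<Sigma>_def by (rule finite_matching[rotated]) simp
          then have "finite (S\<^sub>1 \<inter> S\<^sub>2)" using AB'(3) finite_subset by blast
          from card_mono[OF this \<open>A \<inter> B \<subseteq> S\<^sub>1 \<inter> S\<^sub>2\<close>] lt have "card (A \<inter> B) < t" by linarith
          moreover have "t \<le> card (A \<inter> B)" using F(2) AB' by (simp add: t_intersecting_def)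
          ultimately show False by simp
        qed
      qed (use small S \<delta> in auto)
      also have "\<dots> = fact (n - card S\<^sub>1) * exp (- 1 / (20 * \<delta>\<^sup>2 * m))"
        by (simp add: m_def)
      also have "\<dots> \<le> fact (n - card S\<^sub>1) * exp (- (real n / 83))"
      proof -
        have "20 * \<delta>\<^sup>2 * m \<le> 20 * \<delta>\<^sup>2 * real n" using m by (intro mult_left_mono) auto
        \<comment> \<open>Here \<open>20 * (140 / 69)^2\<close> is about
          \<open>82.3\<close>.\<close>
        also have "\<dots> \<le> 83 / real n" using n by (simp add: \<delta>_def power2_eq_square field_simps)
        finally have "real n * (20 * \<delta>\<^sup>2 * m) \<le> 83" using n by (simp add: field_simps)
        then have "real n / 83 \<le> 1 / (20 * \<delta>\<^sup>2 * m)" using \<delta> m by (simp add: field_simps)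
        then show ?thesis by simp
      qed
      also have "\<dots> < fact (n - card S\<^sub>1) * (29 / 30 * (1 / N))"
        using exp_lt_inverse_power[OF n(1,3)] unfolding N_def by (intro mult_strict_left_mono) auto
      finally have "real (card \<G>\<^sub>1) < fact (n - card S\<^sub>1) / N" by simp
      with G1 show False by (simp add: hom_def)
    qed
    define \<R> where "\<R> = {M \<in> \<F>. \<forall>S\<in>\<S>. \<not> S \<subseteq> M}"
    show "real (card {M \<in> \<F>. \<forall>S\<in>\<S>. \<not> S \<subseteq> M}) \<le> 1 / 10 * fact (n - 2 * t)"
      unfolding \<R>_def[symmetric]
    proof (rule ccontr)
      assume big: "\<not> real (card \<R>) \<le> 1 / 10 * fact (n - 2 * t)"
      then have R0: "\<R> \<noteq> {}" by auto
      have RF: "\<R> \<subseteq> \<F>" by (auto simp: \<R>_def)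
      with F(1) have RS: "\<R> \<subseteq> matchings {1..n} {1..n}" by (simp add: \<Sigma>_def)
      obtain S where S: "{M \<in> \<R>. S \<subseteq> M} \<noteq> {}"
        "2 ^ card S * fact (n - card S) * real (card \<R>) \<le> real (card {M \<in> \<R>. S \<subseteq> M}) * fact n"
        "\<And>x. x \<notin> S \<Longrightarrow> real (card {M \<in> {M \<in> \<R>. S \<subseteq> M}. x \<in> M})
          \<le> 2 / real (n - card S) * real (card {M \<in> \<R>. S \<subseteq> M})"
        using exists_homogeneous_piece[of "{1..n}" "{1..n}" \<R>] RS R0 by auto
      define g where "g = real (card {M \<in> \<R>. S \<subseteq> M})"
      have "fact n \<le> real n ^ (2 * t) * fact (n - 2 * t)"
        using n(2) by (rule fact_le_power_mult_fact)
      also have "\<dots> \<le> real n ^ (2 * t) * (10 * real (card \<R>))"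
        using big by (intro mult_left_mono) auto
      finally have "fact n \<le> N * real (card \<R>)" by (simp add: N_def)
      then have "2 ^ card S * fact (n - card S) * fact n \<le> 2 ^ card S * fact (n - card S) * (N * real (card \<R>))"
        by (intro mult_left_mono) auto
      also have "\<dots> = N * (2 ^ card S * fact (n - card S) * real (card \<R>))" by simp
      also have "\<dots> \<le> N * (g * fact n)"
        using S(2) N by (simp add: g_def)
      finally have "(2 ^ card S * fact (n - card S)) * fact n \<le> (N * g) * fact n" by (simp add: mult_ac)
      \<comment> \<open>This serves twice: with \<open>g \<le> fact (n - card S)\<close> it bounds
        \<open>2 ^ card S\<close> by \<open>N\<close>, so the core is small, and with
        \<open>1 \<le> 2 ^ card S\<close> it shows that the piece is large enough for
        \<open>hom\<close>.\<close>
      then have density: "2 ^ card S * fact (n - card S) \<le> N * g" by simp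
      have "card {M \<in> \<R>. S \<subseteq> M} \<le> card {M \<in> matchings {1..n} {1..n}. S \<subseteq> M}"
        using RS by (intro card_mono) (auto simp: finite_matchings)
      also have "\<dots> \<le> fact (card {1..n} - card S)"
        by (rule card_matchings_superset_le) auto
      finally have "g \<le> real (fact (n - card S))" unfolding g_def by (simp only: of_nat_le_iff) simp
      then have "N * g \<le> N * fact (n - card S)" using N by simp
      with density have "2 ^ card S * fact (n - card S) \<le> N * (fact (n - card S) :: real)" by linarith
      then have "2 ^ card S \<le> N" by simp
      then have "70 * card S \<le> n"
        unfolding N_def by (rule spread_piece_size[OF n(1,3)])
      moreover have "hom S {M \<in> \<R>. S \<subseteq> M}"
        unfolding hom_def
      proof (intro conjI allI impI)
        have "1 * fact (n - card S) \<le> (2 ^ card S * fact (n - card S) :: real)"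
          by (intro mult_right_mono) auto
        with density have "fact (n - card S) \<le> N * g" by linarith
        then show "fact (n - card S) / N \<le> real (card {M \<in> \<R>. S \<subseteq> M})"
          using N by (simp add: g_def field_simps)
      qed (use S RF in auto)
      ultimately have "S \<in> \<S>" by (auto simp: \<S>_def)
      with S(1) show False by (auto simp: \<R>_def)
    qed
  qed
qed

section \<open>The total weight of the discarded sets\<close>

text \<open>From \<open>k\<close> to \<open>Suc k\<close> the binomial grows by at most 2, as
  \<open>k > 2 * t\<close>, and the power by at most \<open>3 * Suc k\<close>, as
  \<open>exp 1 \<le> 3\<close>. The factorial drops by
  \<open>n - k \<ge> 12 * Suc k\<close>.\<close>

lemma branching_weight_halves:
  fixes n t k :: nat
  defines "a \<equiv> \<lambda>k. real ((k choose t) * k ^ (k - t) * fact (n - k))"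
  assumes k: "2 * t < k" "70 * Suc k \<le> n"
  shows "a (Suc k) \<le> a k / 2"
proof -
  have k0: "k > 0" using k by simp
  have "(Suc k - t) * (Suc k choose t) = Suc k * (k choose t)"
    using binomial_absorb_comp[of "Suc k" t] by simp
  moreover have "Suc k * (Suc k choose t) \<le> 2 * ((Suc k - t) * (Suc k choose t))"
    using k by (simp only: mult.assoc[symmetric], intro mult_right_mono) auto
  ultimately have "Suc k * (Suc k choose t) \<le> Suc k * (2 * (k choose t))" by simp
  then have "Suc k choose t \<le> 2 * (k choose t)" using mult_le_cancel1 by blast
  then have binom: "real (Suc k choose t) \<le> 2 * real (k choose t)" by linarith
  have "(1 + 1 / real k) ^ (k - t) \<le> (1 + 1 / real k) ^ k"
    using k0 by (intro power_increasing) auto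
  also have "\<dots> \<le> exp (1 / real k) ^ k"
    by (intro power_mono exp_ge_add_one_self) auto
  also have "\<dots> = exp 1" using k0 by (simp flip: exp_of_nat_mult)
  also have "\<dots> \<le> 3" by (rule exp_le)
  finally have "(1 + 1 / real k) ^ (k - t) * real k ^ (k - t) \<le> 3 * real k ^ (k - t)"
    by (intro mult_right_mono) auto
  moreover have "(1 + 1 / real k) ^ (k - t) * real k ^ (k - t) = real (Suc k) ^ (k - t)"
    using k0 by (simp add: power_mult_distrib[symmetric] field_simps)
  ultimately have "real (Suc k) ^ (k - t) \<le> 3 * real k ^ (k - t)" by (simp only:)
  then have "real (Suc k) ^ (k - t) * real (Suc k) \<le> 3 * real k ^ (k - t) * real (Suc k)"
    by (intro mult_right_mono) auto
  then have pow: "real (Suc k) ^ (Suc k - t) \<le> 3 * real k ^ (k - t) * real (Suc k)"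
    using k by (simp only: Suc_diff_le power_Suc2)
  have nk: "fact (n - k) = real (n - k) * fact (n - Suc k)"
    using k fact_reduce[of "n - k", where 'a = real] by simp
  have "a (Suc k) = real (Suc k choose t) * real (Suc k) ^ (Suc k - t) * fact (n - Suc k)"
    by (simp add: a_def)
  also have "\<dots> \<le> (2 * real (k choose t)) * (3 * real k ^ (k - t) * real (Suc k)) * fact (n - Suc k)"
    using binom pow by (intro mult_right_mono mult_mono) auto
  also have "\<dots> = real (k choose t) * real k ^ (k - t) * fact (n - Suc k) * (6 * real (Suc k))"
    by simp
  also have "\<dots> \<le> real (k choose t) * real k ^ (k - t) * fact (n - Suc k) * (real (n - k) / 2)"
    using k by (intro mult_left_mono) auto
  also have "\<dots> = a k / 2"
    by (simp add: a_def nk)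
  finally show ?thesis .
qed

text \<open>The form of the hypothesis on \<open>n\<close> matches this estimate:
  \<open>2 * 4 ^ t\<close> for the binomial and \<open>4 * (t + 1) * (2 * t) ^ t\<close> for the
  power multiply to \<open>8 * (t + 1) * (8 * t) ^ t\<close>, about \<open>n / 16\<close> at
  most.\<close>

lemma branching_weight_first:
  fixes n t :: nat
  assumes "t \<ge> 1" "n \<ge> 130 * (t + 1) * (8 * t) ^ t"
  shows "real ((Suc (2 * t) choose t) * Suc (2 * t) ^ (Suc (2 * t) - t) * fact (n - Suc (2 * t)))
    \<le> 65 / 1000 * fact (n - 2 * t)"
proof -
  have n: "2080 * t\<^sup>2 \<le> n" using size_bound assms by simp
  have "t * 1 \<le> t\<^sup>2" unfolding power2_eq_square using assms(1) by (intro mult_left_mono) auto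
  with n have n': "2080 * t \<le> n" by simp
  have "Suc (2 * t) choose t \<le> 2 ^ Suc (2 * t)" by (rule binomial_le_pow2)
  also have "\<dots> = 2 * 4 ^ t" by (simp add: power_mult)
  finally have binom: "real (Suc (2 * t) choose t) \<le> real (2 * 4 ^ t)" by (simp only: of_nat_le_iff)
  have "(1 + 1 / (2 * real t)) ^ t \<le> exp (1 / (2 * real t)) ^ t"
    by (intro power_mono exp_ge_add_one_self) auto
  also have "\<dots> = exp (1 / 2)" using assms(1) by (simp flip: exp_of_nat_mult)
  also have "\<dots> \<le> 2"
  proof (rule power2_le_imp_le)
    have "(exp (1 / 2 :: real))\<^sup>2 = exp 1" by (simp flip: exp_double)
    also have "\<dots> \<le> 3" by (rule exp_le)
    finally show "(exp (1 / 2 :: real))\<^sup>2 \<le> 2\<^sup>2" by simp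
  qed simp
  finally have "(1 + 1 / (2 * real t)) ^ t * (2 * real t) ^ t \<le> 2 * (2 * real t) ^ t"
    by (intro mult_right_mono) auto
  moreover have "(1 + 1 / (2 * real t)) * (2 * real t) = real (Suc (2 * t))"
    using assms(1) by (simp add: distrib_right)
  then have "(1 + 1 / (2 * real t)) ^ t * (2 * real t) ^ t = real (Suc (2 * t)) ^ t"
    by (simp only: power_mult_distrib[symmetric])
  ultimately have "real (Suc (2 * t)) ^ t \<le> 2 * (2 * real t) ^ t" by (simp only:)
  then have pow: "real (Suc (2 * t)) ^ Suc t \<le> real (Suc (2 * t)) * (2 * (2 * real t) ^ t)"
    unfolding power_Suc by (intro mult_left_mono) auto
  have nk: "fact (n - 2 * t) = real (n - 2 * t) * fact (n - Suc (2 * t))"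
    using n' assms(1) fact_reduce[of "n - 2 * t", where 'a = real] by simp
  have "real (130 * (t + 1) * (8 * t) ^ t) \<le> real n" using assms(2) by (simp only: of_nat_le_iff)
  then have "130 * (real (t + 1) * (8 * real t) ^ t) \<le> real n"
    by (simp only: of_nat_mult of_nat_power of_nat_numeral mult.assoc)
  moreover have "real (n - 2 * t) = real n - 2 * real t" "2080 * real t \<le> real n" using n' by linarith+
  ultimately have size: "8 * (real (t + 1) * (8 * real t) ^ t) \<le> 65 / 1000 * real (n - 2 * t)"
    by linarith
  have diff: "Suc (2 * t) - t = Suc t" by simp
  have "real ((Suc (2 * t) choose t) * Suc (2 * t) ^ (Suc (2 * t) - t) * fact (n - Suc (2 * t)))
      = real (Suc (2 * t) choose t) * real (Suc (2 * t)) ^ Suc t * fact (n - Suc (2 * t))"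
    by (simp only: diff of_nat_mult of_nat_power of_nat_fact)
  also have "\<dots> \<le> real (2 * 4 ^ t) * (real (Suc (2 * t)) * (2 * (2 * real t) ^ t)) * fact (n - Suc (2 * t))"
    using binom pow by (intro mult_right_mono mult_mono) auto
  also have "\<dots> \<le> real (2 * 4 ^ t) * (2 * real (t + 1) * (2 * (2 * real t) ^ t)) * fact (n - Suc (2 * t))"
    by (intro mult_right_mono mult_left_mono) auto
  also have "\<dots> = 8 * (real (t + 1) * (4 * (2 * real t)) ^ t) * fact (n - Suc (2 * t))"
    unfolding power_mult_distrib[of 4] by simp
  also have "\<dots> \<le> 65 / 1000 * real (n - 2 * t) * fact (n - Suc (2 * t))"
    using size by (intro mult_right_mono) (simp_all add: mult.assoc[symmetric])
  finally show ?thesis by (simp add: nk)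
qed

lemma branching_weight_sum:
  fixes n t q :: nat
  assumes "t \<ge> 1" "n \<ge> 130 * (t + 1) * (8 * t) ^ t" "2 * t < q" "70 * q \<le> n"
  shows "real (\<Sum>k\<in>{2 * t<..q}. (k choose t) * k ^ (k - t) * fact (n - k)) \<le> 13 / 100 * fact (n - 2 * t)"
proof -
  define a where "a k = real ((k choose t) * k ^ (k - t) * fact (n - k))" for k
  have "Suc (2 * t) \<le> q" using assms by simp
  \<comment> \<open>The extra last term \<open>a q\<close> makes the geometric estimate inductive:
    halving pays for the new summand and for the new last term together.\<close>
  then have "sum a {2 * t<..q} + a q \<le> 2 * a (Suc (2 * t))"
    using assms(4)
  proof (induction q rule: dec_induct)
    case base
    have "{2 * t<..Suc (2 * t)} = {Suc (2 * t)}" by auto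
    then show ?case by simp
  next
    case (step q)
    have "{2 * t<..Suc q} = insert (Suc q) {2 * t<..q}" using step.hyps by auto
    then have "sum a {2 * t<..Suc q} = a (Suc q) + sum a {2 * t<..q}" by simp
    moreover have "a (Suc q) \<le> a q / 2"
      unfolding a_def using step by (intro branching_weight_halves) auto
    ultimately show ?case using step by simp
  qed
  moreover have "a q \<ge> 0" by (simp add: a_def)
  moreover have "a (Suc (2 * t)) \<le> 65 / 1000 * fact (n - 2 * t)"
    unfolding a_def using branching_weight_first[OF assms(1,2)] .
  ultimately have "sum a {2 * t<..q} \<le> 13 / 100 * fact (n - 2 * t)" by linarith
  then show ?thesis by (simp add: a_def[abs_def])
qed

text \<open>The cores of the spread approximation are peeled down to size \<open>2 * t\<close>. A
  member containing no kernel set either contains no core or contains a peeled set, so the losses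
  \<open>10 / 100\<close> and \<open>13 / 100\<close> add up.\<close>

lemma exists_kernel:
  fixes n t :: nat
  assumes n: "t \<ge> 1" "n \<ge> 130 * (t + 1) * (8 * t) ^ t"
    and F: "\<F> \<subseteq> matchings {1..n} {1..n}" "t_intersecting t \<F>"
  obtains \<T> where "\<And>U. U \<in> \<T> \<Longrightarrow> card U \<le> 2 * t" "\<And>U. U \<in> \<T> \<Longrightarrow> \<exists>M\<in>matchings {1..n} {1..n}. U \<subseteq> M"
    "t_intersecting t \<T>" "real (card {M \<in> \<F>. \<forall>U\<in>\<T>. \<not> U \<subseteq> M}) \<le> 23 / 100 * fact (n - 2 * t)"
proof -
  let ?\<Sigma> = "matchings {1..n} {1..n}"
  have size: "2080 * t\<^sup>2 \<le> n" using size_bound n by simp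
  have "t * 1 \<le> t\<^sup>2" unfolding power2_eq_square using n(1) by (intro mult_left_mono) auto
  with size n(1) have n': "2080 * t \<le> n" "2080 \<le> n" by simp_all
  have fin: "finite ?\<Sigma>" by (simp add: finite_matchings)
  obtain \<S> where S: "\<And>S. S \<in> \<S> \<Longrightarrow> \<exists>M\<in>\<F>. S \<subseteq> M" "\<And>S. S \<in> \<S> \<Longrightarrow> 70 * card S \<le> n"
    "t_intersecting t \<S>" "real (card {M \<in> \<F>. \<forall>S\<in>\<S>. \<not> S \<subseteq> M}) \<le> 1 / 10 * fact (n - 2 * t)"
    using spread_approximation[OF n'(2) _ ln_bound[OF n(1) size] F] n'(1) by auto
  have S\<Sigma>: "\<exists>M\<in>?\<Sigma>. S \<subseteq> M" if "S \<in> \<S>" for S using S(1)[OF that] F(1) by blast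
  have "\<S> \<subseteq> Pow ({1..n} \<times> {1..n})"
  proof
    fix S assume "S \<in> \<S>"
    from S\<Sigma>[OF this] obtain M where "M \<in> ?\<Sigma>" "S \<subseteq> M" ..
    with matchings_subset[of M] show "S \<in> Pow ({1..n} \<times> {1..n})" by blast
  qed
  note sub = this
  have finS: "finite \<S>" by (rule finite_subset[OF sub]) simp
  have finS': "finite S" if "S \<in> \<S>" for S
    by (rule finite_subset[of _ "{1..n} \<times> {1..n}"]) (use that sub in blast, simp)
  \<comment> \<open>The largest core size that \<open>70 * card S \<le> n\<close> permits, hence the
    level where peeling starts.\<close>
  define q where "q = n div 70"
  have q: "2 * t < q" "70 * q \<le> n" using n' n(1) by (simp_all add: q_def)
  have Sq: "finite S \<and> card S \<le> q" if "S \<in> \<S>" for S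
    using S(2)[OF that] finS'[OF that] by (simp add: q_def)
  from peel[OF finS Sq S(3), of "2 * t" "\<lambda>k. fact (n - k)"] q(1)
  obtain \<T> \<W> where TW: "finite \<W>" "\<forall>U\<in>\<T>. (\<exists>S\<in>\<S>. U \<subseteq> S) \<and> card U \<le> 2 * t"
    "\<forall>S\<in>\<S>. \<exists>U\<in>\<T> \<union> \<W>. U \<subseteq> S" "t_intersecting t \<T>"
    "(\<Sum>W\<in>\<W>. fact (n - card W)) \<le> (\<Sum>k\<in>{2 * t<..q}. (k choose t) * k ^ (k - t) * fact (n - k))"
    by auto
  show thesis
  proof (rule that)
    show "card U \<le> 2 * t" if "U \<in> \<T>" for U using TW(2) that by blast
    show "\<exists>M\<in>?\<Sigma>. U \<subseteq> M" if "U \<in> \<T>" for U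
    proof -
      obtain S where S': "S \<in> \<S>" "U \<subseteq> S" using TW(2) \<open>U \<in> \<T>\<close> by blast
      then show ?thesis using S\<Sigma>[OF S'(1)] by blast
    qed
    show "t_intersecting t \<T>" by fact
    let ?X = "{M \<in> \<F>. \<forall>S\<in>\<S>. \<not> S \<subseteq> M}" and ?Y = "\<Union>W\<in>\<W>. {M \<in> ?\<Sigma>. W \<subseteq> M}"
    have "{M \<in> \<F>. \<forall>U\<in>\<T>. \<not> U \<subseteq> M} \<subseteq> ?X \<union> ?Y"
    proof
      fix M assume M: "M \<in> {M \<in> \<F>. \<forall>U\<in>\<T>. \<not> U \<subseteq> M}"
      show "M \<in> ?X \<union> ?Y"
      proof (cases "M \<in> ?X")
        case False
        with M obtain S where "S \<in> \<S>" "S \<subseteq> M" by blast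
        with TW(3) obtain U where "U \<in> \<T> \<union> \<W>" "U \<subseteq> M" by blast
        with M F(1) show ?thesis by blast
      qed blast
    qed
    moreover have "finite (?X \<union> ?Y)"
      by (rule finite_subset[OF _ fin]) (use F(1) in auto)
    ultimately have "card {M \<in> \<F>. \<forall>U\<in>\<T>. \<not> U \<subseteq> M} \<le> card (?X \<union> ?Y)"
      by (rule card_mono[rotated])
    also have "\<dots> \<le> card ?X + card ?Y" by (rule card_Un_le)
    also have "card ?Y \<le> (\<Sum>W\<in>\<W>. card {M \<in> ?\<Sigma>. W \<subseteq> M})"
      using TW(1) by (rule card_UN_le)
    also have "\<dots> \<le> (\<Sum>W\<in>\<W>. fact (n - card W))"
    proof (rule sum_mono)
      show "card {M \<in> ?\<Sigma>. W \<subseteq> M} \<le> fact (n - card W)" for W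
        using card_matchings_superset_le[of "{1..n}" "{1..n}" W] by simp
    qed
    also have "\<dots> \<le> (\<Sum>k\<in>{2 * t<..q}. (k choose t) * k ^ (k - t) * fact (n - k))" by (rule TW(5))
    finally have "real (card {M \<in> \<F>. \<forall>U\<in>\<T>. \<not> U \<subseteq> M})
        \<le> real (card ?X) + real (\<Sum>k\<in>{2 * t<..q}. (k choose t) * k ^ (k - t) * fact (n - k))"
      by (simp only: of_nat_le_iff of_nat_add[symmetric] add_left_mono)
    also have "\<dots> \<le> 1 / 10 * fact (n - 2 * t) + 13 / 100 * fact (n - 2 * t)"
      using S(4) branching_weight_sum[OF n q] by (rule add_mono)
    finally show "real (card {M \<in> \<F>. \<forall>U\<in>\<T>. \<not> U \<subseteq> M}) \<le> 23 / 100 * fact (n - 2 * t)"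
      by simp
  qed
qed

section \<open>The diversity bound\<close>

text \<open>Once the rows and columns of \<open>S\<close> are deleted, \<open>K\<close> still lies
  on the remaining board, because \<open>S \<union> K\<close> has distinct rows and distinct
  columns.\<close>

lemma card_matchings_superset_avoiding:
  assumes "finite R" "finite C" "card R = card C"
    and inj: "inj_on fst (S \<union> K)" "inj_on snd (S \<union> K)" and sub: "S \<union> K \<subseteq> R \<times> C" and dis: "S \<inter> K = {}"
  shows "int (card {M \<in> matchings R C. S \<subseteq> M \<and> M \<inter> K = {}}) = rook (card R - card S) (card K)"
proof -
  let ?R = "R - fst ` S" and ?C = "C - snd ` S"
  have injS: "inj_on fst S" "inj_on snd S" and injK: "inj_on fst K" "inj_on snd K"
    using inj by (simp_all add: inj_on_Un)
  have S: "fst ` S \<subseteq> R" "snd ` S \<subseteq> C" using sub by auto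
  have finS: "finite (fst ` S)" "finite (snd ` S)" using finite_subset[OF S(1)] finite_subset[OF S(2)] assms by simp_all
  have bij: "bij_betw ((\<union>) S) (matchings ?R ?C) {M \<in> matchings R C. S \<subseteq> M}"
    by (rule bij_betw_matchings_Un[OF injS S])
  have "bij_betw ((\<union>) S) {M \<in> matchings ?R ?C. M \<inter> K = {}} {M \<in> matchings R C. S \<subseteq> M \<and> M \<inter> K = {}}"
  proof (rule bij_betw_subset[OF bij])
    have "{M \<in> matchings R C. S \<subseteq> M \<and> M \<inter> K = {}} = {M \<in> (\<union>) S ` matchings ?R ?C. M \<inter> K = {}}"
      using bij by (auto simp: bij_betw_def)
    also have "\<dots> = (\<union>) S ` {M \<in> matchings ?R ?C. M \<inter> K = {}}"
      using dis by auto
    finally show "(\<union>) S ` {M \<in> matchings ?R ?C. M \<inter> K = {}} = {M \<in> matchings R C. S \<subseteq> M \<and> M \<inter> K = {}}" ..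
  qed auto
  then have "card {M \<in> matchings R C. S \<subseteq> M \<and> M \<inter> K = {}} = card {M \<in> matchings ?R ?C. M \<inter> K = {}}"
    by (simp add: bij_betw_same_card)
  moreover have "K \<subseteq> ?R \<times> ?C"
  proof
    fix x assume x: "x \<in> K"
    have "fst x \<noteq> fst s \<and> snd x \<noteq> snd s" if "s \<in> S" for s
      using inj_onD[OF inj(1), of x s] inj_onD[OF inj(2), of x s] x that dis by auto
    moreover have "x \<in> R \<times> C" using x sub by blast
    ultimately show "x \<in> ?R \<times> ?C" by (auto simp: mem_Times_iff)
  qed
  moreover have "finite (R \<times> C)" using assms by simp
  then have "finite K" using sub finite_subset by blast
  moreover have "card ?R = card R - card S" "card ?C = card R - card S"
    using S finS injS assms(1-3) by (simp_all add: card_Diff_subset card_image)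
  ultimately show ?thesis
    using card_matchings_avoiding[of K ?R ?C] injK assms(1,2) by simp
qed

text \<open>On the board left by \<open>S\<close>, at least a third of the matchings avoid
  \<open>N\<close>, so at most two thirds of the completions of \<open>S\<close> meet
  \<open>N\<close> in a new cell.\<close>

lemma card_matchings_superset_meeting_le:
  assumes "finite R" "finite C" "card R = card C" "card S + 3 \<le> card R"
    and S: "inj_on fst S" "inj_on snd S" "fst ` S \<subseteq> R" "snd ` S \<subseteq> C"
    and N: "inj_on fst N" "inj_on snd N"
  shows "3 * real (card {M \<in> matchings R C. S \<subseteq> M \<and> (M - S) \<inter> N \<noteq> {}}) \<le> 2 * fact (card R - card S)"
proof -
  let ?R = "R - fst ` S" and ?C = "C - snd ` S"
  let ?A = "{M \<in> matchings R C. S \<subseteq> M \<and> (M - S) \<inter> N \<noteq> {}}"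
  have finS: "finite (fst ` S)" "finite (snd ` S)"
    using finite_subset[OF S(3)] finite_subset[OF S(4)] assms by simp_all
  have fin: "finite (matchings ?R ?C)" using assms by (simp add: finite_matchings)
  have card: "card ?R = card R - card S" "card ?C = card R - card S"
    using S finS assms(1-3) by (simp_all add: card_Diff_subset card_image)
  have bij: "bij_betw ((\<union>) S) (matchings ?R ?C) {M \<in> matchings R C. S \<subseteq> M}"
    by (rule bij_betw_matchings_Un[OF S])
  have "?A \<subseteq> (\<union>) S ` {M \<in> matchings ?R ?C. M \<inter> N \<noteq> {}}"
  proof
    fix M assume M: "M \<in> ?A"
    then have "M \<in> (\<union>) S ` matchings ?R ?C" using bij by (simp add: bij_betw_def)
    then obtain M' where M': "M' \<in> matchings ?R ?C" "M = S \<union> M'" by auto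
    with M have "M' \<inter> N \<noteq> {}" by auto
    with M' show "M \<in> (\<union>) S ` {M \<in> matchings ?R ?C. M \<inter> N \<noteq> {}}" by blast
  qed
  then have "card ?A \<le> card {M \<in> matchings ?R ?C. M \<inter> N \<noteq> {}}"
    using fin by (intro surj_card_le) auto
  moreover have "card {M \<in> matchings ?R ?C. M \<inter> N \<noteq> {}} + card {M \<in> matchings ?R ?C. M \<inter> N = {}}
      = fact (card R - card S)"
  proof -
    have "card (matchings ?R ?C)
        = card ({M \<in> matchings ?R ?C. M \<inter> N \<noteq> {}} \<union> {M \<in> matchings ?R ?C. M \<inter> N = {}})"
      by (rule arg_cong[of _ _ card]) blast
    also have "\<dots> = card {M \<in> matchings ?R ?C. M \<inter> N \<noteq> {}} + card {M \<in> matchings ?R ?C. M \<inter> N = {}}"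
      by (rule card_Un_disjoint) (use fin in auto)
    finally show ?thesis using assms(1,2) card by (simp add: card_matchings)
  qed
  ultimately have "card ?A + card {M \<in> matchings ?R ?C. M \<inter> N = {}} \<le> fact (card R - card S)"
    by linarith
  then have "real (card ?A) + real (card {M \<in> matchings ?R ?C. M \<inter> N = {}}) \<le> real (fact (card R - card S))"
    unfolding of_nat_add[symmetric] of_nat_le_iff .
  moreover have "fact (card ?R) \<le> 3 * real (card {M \<in> matchings ?R ?C. M \<inter> N = {}})"
    using assms(1-4) card N by (intro card_matchings_avoiding_ge) auto
  ultimately show ?thesis using card by simp
qed

section \<open>Permutation graphs as matchings, and the diversity minimum\<close>

lemma perm_graph_eq_image: "perm_graph n \<sigma> = (\<lambda>i. (i, \<sigma> i)) ` {1..n}"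
  by (auto simp: perm_graph_def)

lemma Sigma_perms_eq_matchings: "Sigma_perms n = matchings {1..n} {1..n}"
proof (intro equalityI subsetI)
  fix M assume "M \<in> Sigma_perms n"
  then obtain \<sigma> where \<sigma>: "\<sigma> permutes {1..n}" "M = (\<lambda>i. (i, \<sigma> i)) ` {1..n}"
    unfolding Sigma_perms_def perm_graph_eq_image by blast
  have "fst ` M = {1..n}" unfolding \<sigma>(2) image_image by simp
  moreover have "snd ` M = \<sigma> ` {1..n}" unfolding \<sigma>(2) image_image by simp
  then have "snd ` M = {1..n}" using permutes_image[OF \<sigma>(1)] by (rule trans)
  moreover have "inj_on fst M" unfolding \<sigma>(2) by (rule inj_onI) auto
  moreover have "inj_on snd M" unfolding \<sigma>(2)
    by (rule inj_onI) (auto dest: injD[OF permutes_inj[OF \<sigma>(1)]])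
  ultimately show "M \<in> matchings {1..n} {1..n}" unfolding matchings_def bij_betw_def by blast
next
  fix M assume M: "M \<in> matchings {1..n} {1..n}"
  define g where "g = the_inv_into M fst"
  \<comment> \<open>Outside the range the value must be \<open>i\<close> itself, since
    \<open>permutes\<close> requires fixed points there.\<close>
  define \<sigma> where "\<sigma> i = (if i \<in> {1..n} then snd (g i) else i)" for i
  have fst: "bij_betw fst M {1..n}" and snd: "bij_betw snd M {1..n}"
    using M by (auto simp: matchings_def)
  have g: "bij_betw g {1..n} M" unfolding g_def by (rule bij_betw_the_inv_into[OF fst])
  have "bij_betw \<sigma> {1..n} {1..n} = bij_betw (snd \<circ> g) {1..n} {1..n}"
    by (rule bij_betw_cong) (simp add: \<sigma>_def)
  with bij_betw_trans[OF g snd] have "\<sigma> permutes {1..n}"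
    by (intro bij_imp_permutes) (auto simp: \<sigma>_def)
  moreover have "(i, \<sigma> i) = g i" if "i \<in> {1..n}" for i
    using that f_the_inv_into_f_bij_betw[OF fst, of i] by (simp add: \<sigma>_def g_def prod_eq_iff)
  then have "perm_graph n \<sigma> = g ` {1..n}"
    unfolding perm_graph_eq_image by (rule image_cong[OF refl])
  then have "perm_graph n \<sigma> = M" using g by (simp add: bij_betw_def)
  ultimately show "M \<in> Sigma_perms n" by (auto simp: Sigma_perms_def)
qed

lemma t_diversity_le:
  assumes "partial_perm n T" "card T = t"
  shows "t_diversity n t \<F> \<le> card (avoiding \<F> T)"
  unfolding t_diversity_def
proof (rule Min_le)
  have "{T. partial_perm n T \<and> card T = t} \<subseteq> Pow ({1..n} \<times> {1..n})"
    using matchings_subset[of _ "{1..n}" "{1..n}"] unfolding partial_perm_def Sigma_perms_eq_matchings by blast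
  then have "finite {T. partial_perm n T \<and> card T = t}"
    by (rule finite_subset) simp
  then show "finite {card (avoiding \<F> T) |T. partial_perm n T \<and> card T = t}"
    by (simp add: setcompr_eq_image)
qed (use assms in blast)

lemma Int_eq_of_card:
  assumes "t \<le> card (U \<inter> V)" "U \<inter> V \<subseteq> Y" "finite Y" "card Y = t"
  shows "U \<inter> V = Y"
proof (rule card_subset_eq[OF assms(3,2)])
  show "card (U \<inter> V) = card Y"
    using assms(1,4) card_mono[OF assms(3,2)] by simp
qed

section \<open>Triangles in the kernel\<close>

text \<open>A kernel set disjoint from \<open>X\<close> can meet \<open>X \<union> Y\<close> only
  inside \<open>Y\<close>, which has just \<open>t\<close> cells, so it contains \<open>Y\<close>;
  likewise it contains \<open>Z\<close>. Its size leaves no room for more.\<close>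

lemma kernel_avoiding_triangle:
  assumes T: "t_intersecting t \<T>" "\<And>U. U \<in> \<T> \<Longrightarrow> finite U \<and> card U \<le> 2 * t"
    and XYZ: "finite Y" "finite Z" "card Y = t" "card Z = t" "Y \<inter> Z = {}"
    and mem: "X \<union> Y \<in> \<T>" "X \<union> Z \<in> \<T>" and U: "U \<in> \<T>" "U \<inter> X = {}"
  shows "U = Y \<union> Z"
proof -
  have "U \<inter> (X \<union> Y) = Y" "U \<inter> (X \<union> Z) = Z"
    by (rule Int_eq_of_card; use T(1) mem U XYZ in \<open>auto simp: t_intersecting_def\<close>)+
  then have "Y \<union> Z \<subseteq> U" by blast
  moreover have "card U \<le> card (Y \<union> Z)" using XYZ T(2)[OF U(1)] by (simp add: card_Un_disjoint)
  ultimately show ?thesis using T(2)[OF U(1)] card_seteq[of U "Y \<union> Z"] by simp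
qed

text \<open>A member avoiding \<open>Y\<close> and containing a kernel set must contain
  \<open>X \<union> Z\<close>. On \<open>X \<union> Z\<close> it agrees with the exceptional member
  \<open>G\<close> in fewer than \<open>t\<close> cells, so it shares a further cell with
  \<open>G\<close>. At most two thirds of the completions of \<open>X \<union> Z\<close> do
  so.\<close>

lemma card_avoiding_triangle_le:
  fixes n t :: nat
  assumes n: "3 * t + 3 \<le> n"
    and F: "\<F> \<subseteq> matchings {1..n} {1..n}" "t_intersecting t \<F>"
    and T: "t_intersecting t \<T>" "\<And>U. U \<in> \<T> \<Longrightarrow> finite U \<and> card U \<le> 2 * t"
    and XYZ: "finite X" "finite Y" "finite Z" "card X = t" "card Y = t" "card Z = t"
      "X \<inter> Y = {}" "X \<inter> Z = {}" "Y \<inter> Z = {}"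
    and mem: "X \<union> Y \<in> \<T>" "X \<union> Z \<in> \<T>" "Y \<union> Z \<in> \<T>"
    and M: "inj_on fst (X \<union> Z)" "inj_on snd (X \<union> Z)" "X \<union> Z \<subseteq> {1..n} \<times> {1..n}"
    and G: "G \<in> \<F>" "G \<inter> X = {}" "\<not> Z \<subseteq> G"
  shows "real (card (avoiding \<F> Y))
    \<le> 2 / 3 * fact (n - 2 * t) + real (card {M \<in> \<F>. \<forall>U\<in>\<T>. \<not> U \<subseteq> M})"
proof -
  let ?\<Sigma> = "matchings {1..n} {1..n}"
  let ?A = "{M \<in> ?\<Sigma>. X \<union> Z \<subseteq> M \<and> (M - (X \<union> Z)) \<inter> G \<noteq> {}}" and ?E = "{M \<in> \<F>. \<forall>U\<in>\<T>. \<not> U \<subseteq> M}"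
  have fin: "finite ?\<Sigma>" by (simp add: finite_matchings)
  have G\<Sigma>: "G \<in> ?\<Sigma>" using G(1) F(1) by blast
  have card: "card (X \<union> Z) = 2 * t" using XYZ by (simp add: card_Un_disjoint)
  have "G \<inter> Z \<subset> Z" using G(3) by blast
  then have lt: "card (G \<inter> Z) < t" using psubset_card_mono[OF XYZ(3)] XYZ(6) by simp
  have "avoiding \<F> Y \<subseteq> ?A \<union> ?E"
  proof
    fix M assume "M \<in> avoiding \<F> Y"
    then have M': "M \<in> \<F>" "M \<inter> Y = {}" by (auto simp: avoiding_def)
    show "M \<in> ?A \<union> ?E"
    proof (cases "M \<in> ?E")
      case False
      with M' obtain U where U: "U \<in> \<T>" "U \<subseteq> M" by blast
      then have "U \<inter> Y = {}" using M'(2) by blast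
      have "U = X \<union> Z"
        by (rule kernel_avoiding_triangle[OF T, where X = Y])
          (use XYZ mem U \<open>U \<inter> Y = {}\<close> in \<open>simp_all add: Un_commute Int_commute\<close>)
      with U have sub: "X \<union> Z \<subseteq> M" by simp
      have "M \<inter> G \<inter> (M - (X \<union> Z)) \<noteq> {}"
      proof
        assume "M \<inter> G \<inter> (M - (X \<union> Z)) = {}"
        then have "M \<inter> G \<subseteq> G \<inter> Z" using G(2) by blast
        then have "card (M \<inter> G) < t"
          using lt card_mono[of "G \<inter> Z" "M \<inter> G"] XYZ(3) by simp
        moreover have "t \<le> card (M \<inter> G)" using F(2) M' G(1) by (simp add: t_intersecting_def)
        ultimately show False by simp
      qed
      then have "(M - (X \<union> Z)) \<inter> G \<noteq> {}" by blast
      with sub M' F(1) show ?thesis by blast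
    qed blast
  qed
  moreover have "finite (?A \<union> ?E)"
    by (rule finite_subset[OF _ fin]) (use F(1) in blast)
  ultimately have "card (avoiding \<F> Y) \<le> card (?A \<union> ?E)" by (rule card_mono[rotated])
  also have "\<dots> \<le> card ?A + card ?E" by (rule card_Un_le)
  finally have "card (avoiding \<F> Y) \<le> card ?A + card ?E" .
  then have "real (card (avoiding \<F> Y)) \<le> real (card ?A) + real (card ?E)" by linarith
  moreover have "3 * real (card ?A) \<le> 2 * fact (card {1..n} - card (X \<union> Z))"
  proof (rule card_matchings_superset_meeting_le[OF _ _ _ _ M(1,2)])
    show "fst ` (X \<union> Z) \<subseteq> {1..n}" "snd ` (X \<union> Z) \<subseteq> {1..n}"
      by (auto dest!: subsetD[OF M(3)])
  qed (use n card matchings_inj[OF G\<Sigma>] in simp_all)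
  ultimately show ?thesis by (simp add: card)
qed

lemma exists_avoiding_le_rook:
  fixes n t :: nat
  assumes t: "t \<ge> 1" and n: "n \<ge> 130 * (t + 1) * (8 * t) ^ t"
    and F: "\<F> \<subseteq> matchings {1..n} {1..n}" "t_intersecting t \<F>"
  shows "\<exists>T. (\<exists>M\<in>matchings {1..n} {1..n}. T \<subseteq> M) \<and> card T = t
    \<and> int (card (avoiding \<F> T)) \<le> rook (n - 2 * t) t"
proof (rule ccontr)
  let ?\<Sigma> = "matchings {1..n} {1..n}"
  assume none: "\<not> ?thesis"
  have size: "2080 * t\<^sup>2 \<le> n" using size_bound t n by simp
  have "t * 1 \<le> t\<^sup>2" unfolding power2_eq_square using t by (intro mult_left_mono) auto
  with size have n': "2080 * t \<le> n" by simp
  define m where "m = n - 2 * t"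
  have m: "2078 * t \<le> m" "m > 0" using n' t by (simp_all add: m_def)
  obtain \<T> where T: "\<And>U. U \<in> \<T> \<Longrightarrow> card U \<le> 2 * t" "\<And>U. U \<in> \<T> \<Longrightarrow> \<exists>M\<in>?\<Sigma>. U \<subseteq> M"
    "t_intersecting t \<T>" "real (card {M \<in> \<F>. \<forall>U\<in>\<T>. \<not> U \<subseteq> M}) \<le> 23 / 100 * fact (n - 2 * t)"
    by (rule exists_kernel[OF t n F]; (assumption | (rule that; assumption)))
  let ?E = "{M \<in> \<F>. \<forall>U\<in>\<T>. \<not> U \<subseteq> M}"
  have E: "real (card ?E) \<le> 23 / 100 * fact m" using T(4) by (simp add: m_def)
  have finT: "finite U \<and> card U \<le> 2 * t" if U: "U \<in> \<T>" for U
  proof -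
    obtain M where M: "M \<in> ?\<Sigma>" "U \<subseteq> M" using T(2)[OF U] ..
    have "finite M" by (rule finite_matching[OF _ M(1)]) simp
    then show ?thesis using finite_subset[OF M(2)] T(1)[OF U] by simp
  qed
  \<comment> \<open>The linear Bonferroni bound suffices, since \<open>m \<ge> 2078 * t\<close>
    makes its correction less than one percent of \<open>fact m\<close>.\<close>
  have large: "99 / 100 * fact m \<le> real_of_int (rook m t)"
  proof -
    have "real t * fact (m - 1) \<le> 1 / 100 * (real m * fact (m - 1))"
      using m by (simp add: mult_right_mono flip: mult.assoc)
    also have "real m * fact (m - 1) = fact m" using m fact_reduce[of m, where 'a = real] by simp
    finally have "real t * fact (m - 1) \<le> 1 / 100 * fact m" .
    moreover have "real_of_int (fact m - int t * fact (m - 1)) \<le> real_of_int (rook m t)"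
      unfolding of_int_le_iff using m by (intro rook_ge_linear) simp
    ultimately show ?thesis by simp
  qed
  have big: "real_of_int (rook m t) < real (card (avoiding \<F> X))" if "U \<in> \<T>" "X \<subseteq> U" "card X = t" for X U
  proof -
    have "\<exists>M\<in>?\<Sigma>. X \<subseteq> M" using T(2)[OF that(1)] that(2) by blast
    with none that(3) have "rook m t < int (card (avoiding \<F> X))" by (auto simp: m_def not_le)
    then show ?thesis by linarith
  qed
  have finF: "finite \<F>" by (rule finite_subset[OF F(1)]) (simp add: finite_matchings)
  \<comment> \<open>If \<open>X\<close> met every kernel set, all members avoiding \<open>X\<close>
    would be among the few not covered by the kernel, fewer than the rook number.\<close>
  have miss: "\<exists>U\<in>\<T>. U \<inter> X = {}" if X: "\<exists>M\<in>?\<Sigma>. X \<subseteq> M" "card X = t" for X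
  proof (rule ccontr)
    assume "\<not> (\<exists>U\<in>\<T>. U \<inter> X = {})"
    then have "avoiding \<F> X \<subseteq> ?E" by (auto simp: avoiding_def)
    then have "card (avoiding \<F> X) \<le> card ?E" using finF by (intro card_mono) auto
    with E have "real (card (avoiding \<F> X)) \<le> 23 / 100 * fact m" by linarith
    moreover have "rook m t < int (card (avoiding \<F> X))" using none X by (auto simp: m_def not_le)
    then have "real_of_int (rook m t) < real (card (avoiding \<F> X))" by linarith
    moreover have "(fact m :: real) > 0" by simp
    ultimately show False using large by linarith
  qed
  have miss': "\<exists>V\<in>\<T>. V \<inter> X = {}" if "U \<in> \<T>" "X \<subseteq> U" "card X = t" for U X
    using miss[of X] T(2)[OF that(1)] that by blast
  have int: "t \<le> card (U \<inter> V)" if "U \<in> \<T>" "V \<in> \<T>" for U V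
    using T(3) that by (simp add: t_intersecting_def)
  obtain U where U: "U \<in> \<T>"
  proof -
    have "card ?\<Sigma> = fact n" by (simp add: card_matchings)
    then have "?\<Sigma> \<noteq> {}" by (metis card.empty fact_nonzero)
    then obtain M where M: "M \<in> ?\<Sigma>" by blast
    have "t \<le> card M" using card_matching[OF M] n' by simp
    then obtain X where "X \<subseteq> M" "card X = t" by (meson obtain_subset_with_card_n)
    then show thesis using miss[of X] M that by blast
  qed
  \<comment> \<open>A smaller kernel set \<open>V\<close> is impossible: after removing a
    \<open>t\<close>-subset \<open>X\<close>, fewer than \<open>t\<close> cells remain for the
    intersection with a kernel set that avoids \<open>X\<close>.\<close>
  have cardU: "card V = 2 * t" if V: "V \<in> \<T>" for V
  proof (rule ccontr)
    assume "card V \<noteq> 2 * t"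
    with finT[OF V] have lt: "card V < 2 * t" "finite V" by auto
    have "t \<le> card V" using int[OF V V] by simp
    then obtain X where X: "X \<subseteq> V" "card X = t" by (meson obtain_subset_with_card_n)
    from miss'[OF V X] obtain W where W: "W \<in> \<T>" "W \<inter> X = {}" by blast
    then have "V \<inter> W \<subseteq> V - X" by blast
    then have "card (V \<inter> W) \<le> card (V - X)" using lt(2) by (intro card_mono) auto
    also have "\<dots> = card V - t" using X lt(2) finite_subset[of X V] by (simp add: card_Diff_subset)
    finally show False using int[OF V W(1)] lt(1) by simp
  qed
  have finU: "finite U" using finT[OF U] by simp
  have "t \<le> card U" using cardU[OF U] by simp
  then obtain B where B: "B \<subseteq> U" "card B = t" by (meson obtain_subset_with_card_n)
  define A where "A = U - B"
  have finAB: "finite A" "finite B" using finU B finite_subset[of B U] by (simp_all add: A_def)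
  have A: "A \<subseteq> U" "card A = t" "A \<inter> B = {}" "A \<union> B = U"
    using B finAB cardU[OF U] by (auto simp: A_def card_Diff_subset)
  \<comment> \<open>The triangle is built edge by edge: avoiding \<open>B\<close> yields a kernel
    set through \<open>A\<close>, whose other half becomes \<open>C\<close>; avoiding
    \<open>A\<close> then forces \<open>B \<union> C\<close>.\<close>
  obtain V where V: "V \<in> \<T>" "V \<inter> B = {}" using miss'[OF U B] by blast
  have VU: "V \<inter> U = A"
    by (rule Int_eq_of_card[OF int[OF V(1) U]]) (use V A finAB in \<open>auto simp: A_def\<close>)
  define C where "C = V - A"
  have finV: "finite V" using finT[OF V(1)] by simp
  have AV: "A \<subseteq> V" using VU by blast
  have C: "finite C" "card C = t" "A \<inter> C = {}" "B \<inter> C = {}" "A \<union> C = V"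
    using finV AV finAB A cardU[OF V(1)] V(2) by (auto simp: C_def card_Diff_subset)
  obtain W where W: "W \<in> \<T>" "W \<inter> A = {}" using miss'[OF U A(1,2)] by blast
  have WBC: "W = B \<union> C"
    by (rule kernel_avoiding_triangle[OF T(3) finT, where X = A]) (use A C finAB B U V W in simp_all)
  have mem: "A \<union> B \<in> \<T>" "A \<union> C \<in> \<T>" "B \<union> C \<in> \<T>" using A C U V W WBC by simp_all
  have inj: "inj_on fst S \<and> inj_on snd S \<and> S \<subseteq> {1..n} \<times> {1..n}" if S: "S \<in> \<T>" for S
  proof -
    obtain M where M: "M \<in> ?\<Sigma>" "S \<subseteq> M" using T(2)[OF S] ..
    show ?thesis
      using inj_on_subset[OF matchings_inj(1)[OF M(1)] M(2)] inj_on_subset[OF matchings_inj(2)[OF M(1)] M(2)]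
        matchings_subset[OF M(1)] M(2) by blast
  qed
  have n3: "3 * t + 3 \<le> n" using n' t by simp
  \<comment> \<open>A member avoiding \<open>A\<close> but not containing \<open>Z\<close> would
    leave at most \<open>2/3 + 23/100 < 99/100\<close> of \<open>fact m\<close> members avoiding
    \<open>Y\<close>, against \<open>big\<close>. The roles of \<open>B\<close> and \<open>C\<close>
    are interchangeable.\<close>
  have no_defect: "Z \<subseteq> G"
    if "{Y, Z} = {B, C}" "G \<in> \<F>" "G \<inter> A = {}" for Y Z G
  proof (rule ccontr)
    assume Z: "\<not> Z \<subseteq> G"
    have YZ: "Y = B \<and> Z = C \<or> Y = C \<and> Z = B" using that(1) by (auto simp: doubleton_eq_iff)
    then have "A \<union> Z \<in> \<T>" "A \<union> Y \<in> \<T>" "Y \<union> Z \<in> \<T>" using mem by (auto simp: Un_commute)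
    note memAYZ = this
    have "real (card (avoiding \<F> Y)) \<le> 2 / 3 * fact (n - 2 * t) + real (card ?E)"
      by (rule card_avoiding_triangle_le[where X = A and Z = Z and G = G, OF n3 F T(3) finT])
        (use YZ memAYZ inj[OF memAYZ(1)] A B C finAB that(2,3) Z in auto)
    also have "\<dots> \<le> 2 / 3 * fact m + 23 / 100 * fact m"
      using E by (simp add: m_def)
    also have "\<dots> < 99 / 100 * fact m" by simp
    also have "\<dots> \<le> real_of_int (rook m t)" by (rule large)
    also have "\<dots> < real (card (avoiding \<F> Y))"
      by (rule big[OF memAYZ(2)]) (use YZ B C in auto)
    finally show False .
  qed
  have "avoiding \<F> A \<subseteq> {M \<in> ?\<Sigma>. B \<union> C \<subseteq> M \<and> M \<inter> A = {}}"
    using no_defect[of B C] no_defect[of C B] F(1) by (auto simp: avoiding_def insert_commute)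
  then have "card (avoiding \<F> A) \<le> card {M \<in> ?\<Sigma>. B \<union> C \<subseteq> M \<and> M \<inter> A = {}}"
    by (intro card_mono) (simp_all add: finite_matchings)
  also have "int \<dots> = rook (card {1..n} - card (B \<union> C)) (card A)"
  proof (rule card_matchings_superset_avoiding)
    \<comment> \<open>Any two cells of the three sets lie together in one of the pairwise unions,
      each of which is part of a matching.\<close>
    have *: "inj_on f (B \<union> C \<union> A)" if "inj_on f (A \<union> B)" "inj_on f (A \<union> C)" "inj_on f (B \<union> C)"
      for f :: "nat \<times> nat \<Rightarrow> nat"
      using that unfolding inj_on_def by blast
    show "inj_on fst (B \<union> C \<union> A)" "inj_on snd (B \<union> C \<union> A)"
      using inj[OF mem(1)] inj[OF mem(2)] inj[OF mem(3)] by (blast intro: *)+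
    show "B \<union> C \<union> A \<subseteq> {1..n} \<times> {1..n}"
      using inj[OF mem(1)] inj[OF mem(2)] by blast
    show "(B \<union> C) \<inter> A = {}" using A(3) C(3) by blast
  qed simp_all
  also have "card (B \<union> C) = 2 * t" using B C finAB by (simp add: card_Un_disjoint)
  finally have "int (card (avoiding \<F> A)) \<le> rook m t" by (simp add: m_def A)
  with big[OF U A(1,2)] show False by linarith
qed

theorem theorem1p3:
  fixes n t :: nat and \<F> :: "(nat \<times> nat) set set"
  assumes "t \<ge> 1"
    and "\<F> \<subseteq> Sigma_perms n"
    and "t_intersecting t \<F>"
    and "n \<ge> 130 * (t + 1) * (8 * t) ^ t"
  shows "int (t_diversity n t \<F>) \<le>
    (\<Sum>i = 0..t. (-1) ^ i * int (t choose i) * fact (n - 2 * t - i))"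
proof -
  obtain T where T: "\<exists>M\<in>matchings {1..n} {1..n}. T \<subseteq> M" "card T = t"
    "int (card (avoiding \<F> T)) \<le> rook (n - 2 * t) t"
    using exists_avoiding_le_rook[OF assms(1,4) _ assms(3)] assms(2) unfolding Sigma_perms_eq_matchings by blast
  have "partial_perm n T" using T(1) by (simp add: partial_perm_def Sigma_perms_eq_matchings)
  from t_diversity_le[OF this T(2), of \<F>] T(3) show ?thesis
    unfolding rook_def by linarith
qed

end
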